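(* Consider the distributed model predictive control (DMPC) scheme described in the context, with penalty parameter $\rho>0$, horizon $T>0$, sampling time $\Delta t>0$ and stopping constant $d>0$. Suppose that the following hold. (1) There exist a feedback law $u=\kappa_V(x)\in U$ and a non-empty compact set $\Omega_\beta=\{x\in\mathbb{R}^n: V(x)\le\beta\}$ such that $\dot V(x,\kappa_V(x))+l(x,\kappa_V(x))\le 0$ for all $x\in\Omega_\beta$, where $\dot V:=(\partial V/\partial x)F$. (2) The optimal cost $J^*$ is twice continuously differentiable, and the feedback laws $\kappa^*$ and $\kappa$ are locally Lipschitz in their arguments. (3) There exist unique bounded multipliers $\mu^*(\tau;\underline{x}_k)$, $\tau\in[0,T]$, satisfying the saddle point condition $J_\rho(w^*,z^*,\mu;\underline{x}_k)\le J_\rho(w^*,z^*,\mu^*;\underline{x}_k)\le J_\rho(w,z,\mu^*;\underline{x}_k)$, and $\mu^*(\cdot;\underline{x}_k)$ and $z^*(\cdot;\underline{x}_k)$ are locally Lipschitz (in $\underline{x}_k$) for all $\underline{x}_k\in\Gamma_\alpha$. (4) There exist $\sigma_\mu,\sigma_z>0$ such that $\mu^q(\cdot;\underline{x}_k)\in\mathcal{M}_\alpha^{\sigma_\mu}$ and $z^q(\cdot;\underline{x}_k)\in\mathcal{Z}_\alpha^{\sigma_z}$ for the given initialization ($q=0$) and all subsequent ADMM iterations ($q=1,2,\dots$). (5) The ADMM iterates are linearly convergent: for some $C\in[0,1)$, $$\left\|\begin{matrix} z^{q}(\cdot;\underline{x}_k)-z^*(\cdot;\underline{x}_k)\\ \mu^{q}(\cdot;\underline{x}_k)-\mu^*(\cdot;\underline{x}_k)\end{matrix}\right\|_{L^\infty}\le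 C\left\|\begin{matrix} z^{q-1}(\cdot;\underline{x}_k)-z^*(\cdot;\underline{x}_k)\\ \mu^{q-1}(\cdot;\underline{x}_k)-\mu^*(\cdot;\underline{x}_k)\end{matrix}\right\|_{L^\infty}.$$ Then there exists a sufficiently small constant $d>0$ in the ADMM stopping criterion such that, for all initial states $\underline{x}_0\in\Gamma_{\hat\alpha}$ (with $\hat\alpha=\hat\alpha(d,\Delta t)$), the optimal cost $J^*(\underline{x}_k)$ and the error $\|\Delta x_F^{q_k}(\cdot;\underline{x}_k)\|_{L^\infty}$ decay exponentially in $k$, and the DMPC scheme stabilizes the origin exponentially, i.e. there are constants $\gamma_1,\gamma_2>0$ with $\|\underline{x}(t)\|\le\gamma_1e^{-\gamma_2t}$ for all $t\ge0$ along the closed loop.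
   Context: **Norms.** $\|\cdot\|$ is the Euclidean norm and $\|z\|_{L^\infty}:=\sup_{t\in[0,T]}\|z(t)\|$. For a set $S$ and $\sigma>0$, $S^\sigma$ is the $\sigma$-neighborhood $\{x:\ \|x-\tilde x\|\le\sigma\text{ for some }\tilde x\in S\}$ (for sets of functions, in the $L^\infty$-norm). $[a_j]_{j\in A}$ denotes stacking. **System.** Let $\mathcal{G}=(\mathcal{V},\mathcal{E})$ be a directed graph, $\mathcal{V}=\{1,\dots,N\}$, $\mathcal{N}_{i\leftarrow}=\{j:(j,i)\in\mathcal{E},\,j\ne i\}$. Subsystem $i$ has dynamics $\dot{\underline{x}}_i=f_i(\underline{x}_i,\underline{u}_i,[\underline{x}_j]_{j\in\mathcal{N}_{i\leftarrow}})$, with $\underline{x}_i\in\mathbb{R}^{n_i}$, $\underline{u}_i\in\mathbb{R}^{m_i}$; $p_i:=\sum_{j\in\mathcal{N}_{i\leftarrow}}n_j$, $p=\sum_ip_i$, $n=\sum_in_i$, $m=\sum_im_i$. In stacked form: $\dot{\underline{x}}=F(\underline{x},\underline{u})$, $F=[f_i]_{i\in\mathcal{V}}$, with $f_i(0,0,0)=0$. (Underlined symbols are plant variables, the others are MPC-internal.) **Centralized MPC problem.** Given $\underline{x}_k=\underline{x}(t_k)$, $t_k=k\Delta t$: minimize over $u$ $$J(u,\underline{x}_k)=V(x(T))+\int_0^Tl(x(\tau),u(\tau))\,d\tau\quad\text{s.t. }\dot x=F(x,u),\ x(0)=\underline{x}_k,\ u(\tau)\in U,$$ $V(x)=\sum_iV_i(x_i)$,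 $l(x,u)=\sum_il_i(x_i,u_i)$, $U=\prod_iU_i$ with $U_i$ compact and convex. The optimal solution is $(x^*,u^* )(\tau;\underline{x}_k)$, the optimal cost is $J^*(\underline{x}_k)$, and the optimal feedback law $\kappa^*$ is defined by $u^*(\tau;\underline{x}_k)=\kappa^*(x^*(\tau;\underline{x}_k);\underline{x}_k)$. Standing assumptions: there are $m_l,M_l>0$, $m_V,M_V\ge0$ with $m_l(\|x\|^2+\|u\|^2)\le l(x,u)\le M_l(\|x\|^2+\|u\|^2)$ and $m_V\|x\|^2\le V(x)\le M_V\|x\|^2$; the functions $f_i$, $V_i$, $l_i$ are continuously differentiable; every bounded control $u(t)\in U$, $t\in[0,T]$, yields a bounded state response; an optimal solution exists. **Level sets.** $\Gamma_\alpha=\{x\in\mathbb{R}^n: J^*(x)\le\alpha\}$ with $\alpha=\beta(1+\frac{m_l}{M_V}T)$, where $\beta$ is from hypothesis (1); similarly $\Gamma_{\hat\alpha}=\{x: J^*(x)\le\hat\alpha\}$. **ADMM.** Local copies $v_i=[v_{ji}]_{j\in\mathcal{N}_{i\leftarrow}}$ and coordination variables $z_i$ are introduced, with decoupled dynamics $\dot x_i=f_i(x_i,u_i,v_i)$, $x_i(0)=\underline{x}_{k,i}$, and consistency constraints $z_i-x_i=0$, $z_j-v_{ji}=0$ ($j\in\mathcal{N}_{i\leftarrow}$). Let $w=[(u_i,v_i)]_{i\in\mathcal{V}}$, $z=[z_i]_{i\in\mathcal{V}}$, $\mu=[\mu_i]_{i\in\mathcal{V}}$, $\mu_i=(\mu_{ii},[\mu_{ji}]_{j\in\mathcal{N}_{i\leftarrow}})$.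 Augmented Lagrangian (subject to the decoupled dynamics, $J$ evaluated along them): $$J_\rho(w,z,\mu;\underline{x}_k)=J(u;\underline{x}_k)+\sum_{i\in\mathcal{V}}\int_0^T\Big[\mu_{ii}^{T}(z_i-x_i)+\tfrac\rho2\|z_i-x_i\|^2+\sum_{j\in\mathcal{N}_{i\leftarrow}}\big(\mu_{ji}^{T}(z_j-v_{ji})+\tfrac\rho2\|z_j-v_{ji}\|^2\big)\Big]d\tau .$$ $(w^*,z^*,\mu^* )(\tau;\underline{x}_k)$ denotes the optimal (saddle point) triple. With $\mathcal{W}=\{(u,v)\in L^\infty_{m+p}(0,T): u(t)\in U\ \forall t\}$, iteration $q\ge1$ is: $w^q=\arg\min_{w\in\mathcal{W}}J_\rho(w,z^{q-1},\mu^{q-1};\underline{x}_k)$; $z^q=\arg\min_zJ_\rho(w^q,z,\mu^{q-1};\underline{x}_k)$; $\mu^q_{ii}=\mu^{q-1}_{ii}+\rho(z_i^q-x_i^q)$, $\mu^q_{ji}=\mu^{q-1}_{ji}+\rho(z_j^q-v_{ji}^q)$, where $x^q$ is the decoupled state belonging to $w^q$. (These steps separate over the agents $i$.) In MPC step $k$ the iterations stop at the first $q=:q_k$ for which the stopping criterion $$\left\|\begin{matrix}z_i^q-z_i^{q-1}\\ \mu_i^q-\mu_i^{q-1}\end{matrix}\right\|_{L^\infty}\le d\,\|\underline{x}_{k,i}\|\quad\text{for all }i\in\mathcal{V}$$ holds. Initial trajectories $(z^0,\mu^0)$ are given for $k=0$; afterwards warm start: $\mu^0(\tau;\underline{x}_{k+1})=\mu^{q_k}(\tau;\underline{x}_k)$,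 $z^0(\tau;\underline{x}_{k+1})=z^{q_k}(\tau;\underline{x}_k)$. The feedback law $\kappa$ is defined by $u^{q_k}(\tau;\underline{x}_k)=\kappa(x^{q_k}(\tau;\underline{x}_k);z^{q_k-1},\mu^{q_k-1},\underline{x}_k)$, and $\kappa^*(\cdot;\underline{x}_k)=\kappa(\cdot;z^*,\mu^*,\underline{x}_k)$. $\mathcal{M}_\alpha:=\{\mu^*(\cdot;\underline{x}_k):\underline{x}_k\in\Gamma_\alpha\}$ and $\mathcal{Z}_\alpha:=\{z^*(\cdot;\underline{x}_k):\underline{x}_k\in\Gamma_\alpha\}$ are compact and non-empty. **Closed loop and error.** The plant input is $\underline{u}(t_k+\tau)=u^{q_k}(\tau;\underline{x}_k)$, $\tau\in[0,\Delta t)$. $x_F^{q_k}(\cdot;\underline{x}_k)$ solves $\dot x_F^{q_k}=F(x_F^{q_k},u^{q_k})$, $x_F^{q_k}(0)=\underline{x}_k$, on $[0,T]$. Thus $\underline{x}(t_k+\tau)=x_F^{q_k}(\tau;\underline{x}_k)$ for $\tau\in[0,\Delta t]$ and $\underline{x}_{k+1}=x_F^{q_k}(\Delta t;\underline{x}_k)$. The error is $\Delta x_F^{q_k}(\tau;\underline{x}_k):=x_F^{q_k}(\tau;\underline{x}_k)-x^*(\tau;\underline{x}_k)$, $\tau\in[0,T]$. **The value $\hat\alpha$.** $\hat\alpha(d,\Delta t)=\dfrac{m_J\,\alpha}{M_J\,(e^{\hat L\Delta t}+Dd)^2}$. Here $L_f,L_{\kappa^*},L_\kappa>0$ are finite Lipschitz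 constants of the dynamics $f=[f_i]_{i\in\mathcal{V}}$ (in $(x,u,v)$; also $\|F(x,u)\|\le L_f(\|x\|+\|u\|)$), of $\kappa^*$ (with $\|\kappa^*(x;\underline{x}_k)\|\le L_{\kappa^*}\|x\|$) and of $\kappa$, on the compact sets in which the trajectories involved evolve for $\underline{x}_k\in\Gamma_\alpha$; $\hat L=L_f(1+L_{\kappa^*})$; $m_J=\frac{m_l}{2\hat L}(1-e^{-2\hat LT})$, $M_J=M_Ve^{2\hat LT}+\frac{M_l}{2\hat L}(1+L_{\kappa^*}^2)(e^{2\hat LT}-1)$; $D=\frac{2\sqrt p}{\rho}NL_fTe^{L_f(1+\sqrt p)T}+K_1Te^{K_2T}$, $K_1=\big(L_f\frac{2\sqrt p}{\rho}+\frac{2L_\kappa}{1-C}\big)N$, $K_2=L_f(1+\sqrt p+L_\kappa)$. **Exponential decay** of a nonnegative sequence $(a_k)$ means $a_k\le c\,\theta^k$ for constants $c>0$, $\theta\in(0,1)$; here the constants (and $\gamma_1,\gamma_2$) are uniform over $\underline{x}_0\in\Gamma_{\hat\alpha}$. *)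

theory Defs
  imports "HOL-Analysis.Analysis"
begin

section \<open>Trajectories and the sup norm\<close>

definition supnorm :: "real \<Rightarrow> (real \<Rightarrow> 'a::real_normed_vector) \<Rightarrow> real" where
  "supnorm T g = (SUP t\<in>{0..T}. norm (g t))"

definition Linf :: "real \<Rightarrow> 'a::euclidean_space set \<Rightarrow> (real \<Rightarrow> 'a) set" where
  "Linf T A = {g \<in> borel_measurable (lebesgue_on {0..T}). bounded (g ` {0..T}) \<and> g ` {0..T} \<subseteq> A}"

text \<open>The sigma-neighbourhood of a set of trajectories inside the trajectory space \<open>L\<close>; the
  membership in \<open>L\<close> (bounded trajectories) keeps the real-valued supremum meaningful.\<close>
definition Linf_nbhd ::
    "real \<Rightarrow> (real \<Rightarrow> 'a::euclidean_space) set \<Rightarrow> (real \<Rightarrow> 'a) set \<Rightarrow> real \<Rightarrow> (real \<Rightarrow> 'a) set" where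
  "Linf_nbhd T L A \<sigma> = {g \<in> L. \<exists>h\<in>A. supnorm T (\<lambda>t. g t - h t) \<le> \<sigma>}"

text \<open>Compactness in the metric space of bounded functions on \<open>{0..T}\<close>; trajectories are
  restricted to \<open>{0..T}\<close> because their values elsewhere are irrelevant.\<close>
definition Linf_compact :: "real \<Rightarrow> (real \<Rightarrow> 'a::euclidean_space) set \<Rightarrow> bool" where
  "Linf_compact T A \<longleftrightarrow>
     compactin
       (Metric_space.mtopology {g \<in> extensional {0..T}. bounded (g ` {0..T})}
          (\<lambda>g h. supnorm T (\<lambda>t. g t - h t)))
       ((\<lambda>g. restrict g {0..T}) ` A)"

text \<open>Local Lipschitz continuity of \<open>f\<close> on \<open>A\<close> with respect to given distance functions (needed
  because some arguments and values are trajectories, measured by the sup norm).\<close>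
definition loc_lipschitz ::
    "('a \<Rightarrow> 'a \<Rightarrow> real) \<Rightarrow> ('b \<Rightarrow> 'b \<Rightarrow> real) \<Rightarrow> 'a set \<Rightarrow> ('a \<Rightarrow> 'b) \<Rightarrow> bool" where
  "loc_lipschitz dA dB A f \<longleftrightarrow>
     (\<forall>a\<in>A. \<exists>r>0. \<exists>L. \<forall>x\<in>A. \<forall>y\<in>A. dA a x < r \<longrightarrow> dA a y < r \<longrightarrow> dB (f x) (f y) \<le> L * dA x y)"

definition C1_map :: "('a::real_normed_vector \<Rightarrow> 'b::real_normed_vector) \<Rightarrow> bool" where
  "C1_map g \<longleftrightarrow>
     (\<exists>g' :: 'a \<Rightarrow> 'a \<Rightarrow>\<^sub>L 'b.
        (\<forall>x. (g has_derivative blinfun_apply (g' x)) (at x)) \<and> continuous_on UNIV g')"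

definition C2_map :: "('a::real_normed_vector \<Rightarrow> 'b::real_normed_vector) \<Rightarrow> bool" where
  "C2_map g \<longleftrightarrow>
     (\<exists>g' :: 'a \<Rightarrow> 'a \<Rightarrow>\<^sub>L 'b.
        (\<forall>x. (g has_derivative blinfun_apply (g' x)) (at x)) \<and> C1_map g')"

text \<open>Solution on \<open>{0..T}\<close> of \<open>x' = g t x\<close>, \<open>x 0 = x0\<close> in the sense of Caratheodory
  (the right-hand side depends on a merely measurable control).\<close>
definition solves :: "real \<Rightarrow> (real \<Rightarrow> 'a::euclidean_space \<Rightarrow> 'a) \<Rightarrow> 'a \<Rightarrow> (real \<Rightarrow> 'a) \<Rightarrow> bool" where
  "solves T g x0 x \<longleftrightarrow>
     continuous_on {0..T} x \<and> x 0 = x0 \<and>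
     (\<forall>t\<in>{0..T}. ((\<lambda>s. g s (x s)) has_integral (x t - x0)) {0..t})"

text \<open>Exponential decay with constants uniform over the initial states in \<open>A\<close>. The closed loop
  from \<open>x0\<close> may be undefined from some step on (see \<open>halts\<close> below); the bound is claimed for
  the steps \<open>k\<close> with \<open>R x0 k\<close>.\<close>
definition exp_decay_on :: "'a set \<Rightarrow> ('a \<Rightarrow> nat \<Rightarrow> bool) \<Rightarrow> ('a \<Rightarrow> nat \<Rightarrow> real) \<Rightarrow> bool" where
  "exp_decay_on A R a \<longleftrightarrow>
     (\<exists>c>0. \<exists>\<theta>. 0 < \<theta> \<and> \<theta> < 1 \<and> (\<forall>x0\<in>A. \<forall>k. R x0 k \<longrightarrow> a x0 k \<le> c * \<theta> ^ k))"

section \<open>The networked system and the central MPC problem\<close>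

text \<open>The finite type \<open>'v\<close> is the set of agents (so \<open>N = CARD('v)\<close>). The coordinates of the stacked
  state and input are the finite types \<open>'n\<close> and \<open>'m\<close>; \<open>sown\<close> and \<open>iown\<close> tell which agent
  owns a coordinate. Thus the space \<open>R^n_i\<close> of agent \<open>i\<close> is the coordinate subspace of
  \<open>real^'n\<close> of the coordinates with owner \<open>i\<close> (dimension \<open>n_i = card {c. sown c = i}\<close>), and
  Euclidean norms agree. The neighbour argument \<open>[x_j]_{j in N_i}\<close> of agent \<open>i\<close> is
  likewise the part of \<open>real^'n\<close> with coordinates owned by a neighbour of \<open>i\<close>, and a family
  \<open>[v_i]_i\<close> of local copies is an element of \<open>real^'n^'v\<close>. The functions \<open>dyn i\<close>,
  \<open>tcost i\<close>, \<open>scost i\<close> (i.e. \<open>f_i\<close>, \<open>V_i\<close>, \<open>l_i\<close>) are only ever evaluated on these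
  blocks.\<close>
record ('v, 'n::finite, 'm::finite) plant =
  sown :: "'n \<Rightarrow> 'v"
  iown :: "'m \<Rightarrow> 'v"
  edges :: "('v \<times> 'v) set"
  dyn :: "'v \<Rightarrow> real^'n \<Rightarrow> real^'m \<Rightarrow> real^'n \<Rightarrow> real^'n"
  tcost :: "'v \<Rightarrow> real^'n \<Rightarrow> real"
  scost :: "'v \<Rightarrow> real^'n \<Rightarrow> real^'m \<Rightarrow> real"
  inset :: "'v \<Rightarrow> (real^'m) set"
  hor :: real    (* T *)
  samp :: real   (* Delta t *)
  pen :: real    (* rho *)

definition nbr :: "('v::finite, 'n::finite, 'm::finite, 'z) plant_scheme \<Rightarrow> 'v \<Rightarrow> 'v set" where
  "nbr P i = {j. (j, i) \<in> edges P \<and> j \<noteq> i}"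

definition sblk :: "('v::finite, 'n::finite, 'm::finite, 'z) plant_scheme \<Rightarrow> 'v \<Rightarrow> real^'n \<Rightarrow> real^'n" where
  "sblk P i x = (\<chi> c. if sown P c = i then x $ c else 0)"

definition iblk :: "('v::finite, 'n::finite, 'm::finite, 'z) plant_scheme \<Rightarrow> 'v \<Rightarrow> real^'m \<Rightarrow> real^'m" where
  "iblk P i u = (\<chi> c. if iown P c = i then u $ c else 0)"

text \<open>The stacking \<open>[x_j]_{j in N_i}\<close>.\<close>
definition nblk :: "('v::finite, 'n::finite, 'm::finite, 'z) plant_scheme \<Rightarrow> 'v \<Rightarrow> real^'n \<Rightarrow> real^'n" where
  "nblk P i x = (\<chi> c. if sown P c \<in> nbr P i then x $ c else 0)"

text \<open>The space \<open>R^p\<close> of all local copies, and the copies that agree with a given state.\<close>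
definition copies :: "('v::finite, 'n::finite, 'm::finite, 'z) plant_scheme \<Rightarrow> (real^'n^'v) set" where
  "copies P = {v. \<forall>i. nblk P i (v $ i) = v $ i}"

definition copy :: "('v::finite, 'n::finite, 'm::finite, 'z) plant_scheme \<Rightarrow> real^'n \<Rightarrow> real^'n^'v" where
  "copy P x = (\<chi> i. nblk P i x)"

definition pdim :: "('v::finite, 'n::finite, 'm::finite, 'z) plant_scheme \<Rightarrow> nat" where
  "pdim P = (\<Sum>i\<in>UNIV. \<Sum>j\<in>nbr P i. card {c. sown P c = j})"

text \<open>Decoupled dynamics \<open>f = [f_i]_i\<close> in \<open>(x, u, v)\<close>, and \<open>F\<close>.\<close>
definition fdec ::
    "('v::finite, 'n::finite, 'm::finite, 'z) plant_scheme \<Rightarrow> real^'n \<Rightarrow> real^'m \<Rightarrow> real^'n^'v \<Rightarrow> real^'n" where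
  "fdec P x u v =
     (\<Sum>i\<in>UNIV. sblk P i (dyn P i (sblk P i x) (iblk P i u) (nblk P i (v $ i))))"

definition Fdyn ::
    "('v::finite, 'n::finite, 'm::finite, 'z) plant_scheme \<Rightarrow> real^'n \<Rightarrow> real^'m \<Rightarrow> real^'n" where
  "Fdyn P x u = fdec P x u (copy P x)"

definition Vcost :: "('v::finite, 'n::finite, 'm::finite, 'z) plant_scheme \<Rightarrow> real^'n \<Rightarrow> real" where
  "Vcost P x = (\<Sum>i\<in>UNIV. tcost P i (sblk P i x))"

definition lcost :: "('v::finite, 'n::finite, 'm::finite, 'z) plant_scheme \<Rightarrow> real^'n \<Rightarrow> real^'m \<Rightarrow> real" where
  "lcost P x u = (\<Sum>i\<in>UNIV. scost P i (sblk P i x) (iblk P i u))"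

definition Uset :: "('v::finite, 'n::finite, 'm::finite, 'z) plant_scheme \<Rightarrow> (real^'m) set" where
  "Uset P = {u. \<forall>i. iblk P i u \<in> inset P i}"

definition controls :: "('v::finite, 'n::finite, 'm::finite, 'z) plant_scheme \<Rightarrow> (real \<Rightarrow> real^'m) set" where
  "controls P = Linf (hor P) (Uset P)"

definition is_resp ::
    "('v::finite, 'n::finite, 'm::finite, 'z) plant_scheme \<Rightarrow> (real \<Rightarrow> real^'m) \<Rightarrow> real^'n \<Rightarrow> (real \<Rightarrow> real^'n) \<Rightarrow> bool" where
  "is_resp P u x0 x \<longleftrightarrow> solves (hor P) (\<lambda>s y. Fdyn P y (u s)) x0 x"

text \<open>Responses are unique on \<open>{0..T}\<close> for continuously differentiable dynamics, so the choice only
  names the response (its values outside \<open>{0..T}\<close> are never used).\<close>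
definition resp ::
    "('v::finite, 'n::finite, 'm::finite, 'z) plant_scheme \<Rightarrow> (real \<Rightarrow> real^'m) \<Rightarrow> real^'n \<Rightarrow> real \<Rightarrow> real^'n" where
  "resp P u x0 = (SOME x. is_resp P u x0 x)"

definition run_cost ::
    "('v::finite, 'n::finite, 'm::finite, 'z) plant_scheme \<Rightarrow> (real \<Rightarrow> real^'n) \<Rightarrow> (real \<Rightarrow> real^'m) \<Rightarrow> real" where
  "run_cost P x u = Vcost P (x (hor P)) + integral {0..hor P} (\<lambda>\<tau>. lcost P (x \<tau>) (u \<tau>))"

definition Jcost ::
    "('v::finite, 'n::finite, 'm::finite, 'z) plant_scheme \<Rightarrow> (real \<Rightarrow> real^'m) \<Rightarrow> real^'n \<Rightarrow> real" where
  "Jcost P u x0 = run_cost P (resp P u x0) u"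

definition Jopt :: "('v::finite, 'n::finite, 'm::finite, 'z) plant_scheme \<Rightarrow> real^'n \<Rightarrow> real" where
  "Jopt P x0 = (INF u\<in>controls P. Jcost P u x0)"

definition level :: "('v::finite, 'n::finite, 'm::finite, 'z) plant_scheme \<Rightarrow> real \<Rightarrow> (real^'n) set" where
  "level P \<alpha> = {x. Jopt P x \<le> \<alpha>}"

section \<open>ADMM and the DMPC closed loop\<close>

text \<open>A multiplier \<open>mu\<close> is a pair: the stacking of the \<open>mu_ii\<close>, and the family (indexed by
  \<open>i\<close>) of the stackings \<open>[mu_ji]_{j in N_i}\<close>.\<close>
type_synonym ('v, 'n) mult = "(real^'n) \<times> (real^'n^'v)"
type_synonym ('v, 'n, 'm) wtraj = "(real \<Rightarrow> real^'m) \<times> (real \<Rightarrow> real^'n^'v)"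

text \<open>
  \<open>optu\<close>: the optimal control \<open>u*(.; x_k)\<close>; \<open>optmu\<close>: the optimal multiplier \<open>mu*(.; x_k)\<close>;
  \<open>kopt\<close>: the law \<open>kappa*(x; x_k)\<close>; \<open>klaw\<close>: the law \<open>kappa(x; z, mu, x_k)\<close>;
  \<open>argw z mu x_k\<close> and \<open>argz w mu x_k\<close>: the minimizers computed in the two ADMM
  minimization steps (fixed as functions since minimizers are determined at most up to null sets);
  \<open>zinit\<close>, \<open>muinit\<close>: the initial trajectories of MPC step 0.\<close>
record ('v::finite, 'n::finite, 'm::finite) dmpc = "('v, 'n, 'm) plant" +
  optu :: "real^'n \<Rightarrow> real \<Rightarrow> real^'m"
  optmu :: "real^'n \<Rightarrow> real \<Rightarrow> ('v, 'n) mult"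
  kopt :: "real^'n \<Rightarrow> real^'n \<Rightarrow> real^'m"
  klaw :: "real^'n \<Rightarrow> (real \<Rightarrow> real^'n) \<Rightarrow> (real \<Rightarrow> ('v, 'n) mult) \<Rightarrow> real^'n \<Rightarrow> real^'m"
  argw :: "(real \<Rightarrow> real^'n) \<Rightarrow> (real \<Rightarrow> ('v, 'n) mult) \<Rightarrow> real^'n \<Rightarrow> ('v, 'n, 'm) wtraj"
  argz :: "('v, 'n, 'm) wtraj \<Rightarrow> (real \<Rightarrow> ('v, 'n) mult) \<Rightarrow> real^'n \<Rightarrow> real \<Rightarrow> real^'n"
  zinit :: "real^'n \<Rightarrow> real \<Rightarrow> real^'n"
  muinit :: "real^'n \<Rightarrow> real \<Rightarrow> ('v, 'n) mult"

definition ztrajs :: "('v::finite, 'n::finite, 'm::finite, 'z) plant_scheme \<Rightarrow> (real \<Rightarrow> real^'n) set" where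
  "ztrajs P = Linf (hor P) UNIV"

definition mutrajs :: "('v::finite, 'n::finite, 'm::finite, 'z) plant_scheme \<Rightarrow> (real \<Rightarrow> ('v, 'n) mult) set" where
  "mutrajs P = Linf (hor P) (UNIV \<times> copies P)"

definition is_dresp ::
    "('v::finite, 'n::finite, 'm::finite, 'z) plant_scheme \<Rightarrow> ('v, 'n, 'm) wtraj \<Rightarrow> real^'n \<Rightarrow> (real \<Rightarrow> real^'n) \<Rightarrow> bool" where
  "is_dresp P w x0 x \<longleftrightarrow> solves (hor P) (\<lambda>s y. fdec P y (fst w s) (snd w s)) x0 x"

definition dresp ::
    "('v::finite, 'n::finite, 'm::finite, 'z) plant_scheme \<Rightarrow> ('v, 'n, 'm) wtraj \<Rightarrow> real^'n \<Rightarrow> real \<Rightarrow> real^'n" where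
  "dresp P w x0 = (SOME x. is_dresp P w x0 x)"

text \<open>The set \<open>W\<close>, restricted to those \<open>w\<close> for which the decoupled dynamics have a solution on
  \<open>{0..T}\<close> (otherwise the augmented Lagrangian is undefined).\<close>
definition wtrajs ::
    "('v::finite, 'n::finite, 'm::finite, 'z) plant_scheme \<Rightarrow> real^'n \<Rightarrow> ('v, 'n, 'm) wtraj set" where
  "wtrajs P x0 = {w. fst w \<in> controls P \<and> snd w \<in> Linf (hor P) (copies P) \<and> (\<exists>x. is_dresp P w x0 x)}"

definition auglag ::
    "('v::finite, 'n::finite, 'm::finite, 'z) plant_scheme \<Rightarrow> ('v, 'n, 'm) wtraj \<Rightarrow> (real \<Rightarrow> real^'n) \<Rightarrow>
     (real \<Rightarrow> ('v, 'n) mult) \<Rightarrow> real^'n \<Rightarrow> real" where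
  "auglag P w z \<mu> x0 =
     (let x = dresp P w x0; v = snd w in
      run_cost P x (fst w) +
      (\<Sum>i\<in>UNIV. integral {0..hor P} (\<lambda>\<tau>.
         sblk P i (fst (\<mu> \<tau>)) \<bullet> sblk P i (z \<tau> - x \<tau>)
         + pen P / 2 * (norm (sblk P i (z \<tau> - x \<tau>)))\<^sup>2
         + (\<Sum>j\<in>nbr P i.
              sblk P j (snd (\<mu> \<tau>) $ i) \<bullet> sblk P j (z \<tau> - v \<tau> $ i)
              + pen P / 2 * (norm (sblk P j (z \<tau> - v \<tau> $ i)))\<^sup>2))))"

text \<open>The optimal triple satisfies the consistency constraints, hence \<open>z* = x*\<close> and
  \<open>v*_ji = x*_j\<close>.\<close>
definition optx :: "('v::finite, 'n::finite, 'm::finite) dmpc \<Rightarrow> real^'n \<Rightarrow> real \<Rightarrow> real^'n" where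
  "optx P xk = resp P (optu P xk) xk"

definition optz :: "('v::finite, 'n::finite, 'm::finite) dmpc \<Rightarrow> real^'n \<Rightarrow> real \<Rightarrow> real^'n" where
  "optz P xk = optx P xk"

definition optw :: "('v::finite, 'n::finite, 'm::finite) dmpc \<Rightarrow> real^'n \<Rightarrow> ('v, 'n, 'm) wtraj" where
  "optw P xk = (optu P xk, \<lambda>\<tau>. copy P (optx P xk \<tau>))"

definition saddle :: "('v::finite, 'n::finite, 'm::finite) dmpc \<Rightarrow> real^'n \<Rightarrow> (real \<Rightarrow> ('v, 'n) mult) \<Rightarrow> bool" where
  "saddle P xk \<mu>s \<longleftrightarrow>
     (\<forall>\<mu>\<in>mutrajs P. auglag P (optw P xk) (optz P xk) \<mu> xk \<le> auglag P (optw P xk) (optz P xk) \<mu>s xk) \<and>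
     (\<forall>w\<in>wtrajs P xk. \<forall>z\<in>ztrajs P. auglag P (optw P xk) (optz P xk) \<mu>s xk \<le> auglag P w z \<mu>s xk)"

definition is_argw ::
    "('v::finite, 'n::finite, 'm::finite) dmpc \<Rightarrow> (real \<Rightarrow> real^'n) \<Rightarrow> (real \<Rightarrow> ('v, 'n) mult) \<Rightarrow> real^'n \<Rightarrow>
     ('v, 'n, 'm) wtraj \<Rightarrow> bool" where
  "is_argw P z \<mu> xk w \<longleftrightarrow>
     w \<in> wtrajs P xk \<and> (\<forall>w'\<in>wtrajs P xk. auglag P w z \<mu> xk \<le> auglag P w' z \<mu> xk)"

definition is_argz ::
    "('v::finite, 'n::finite, 'm::finite) dmpc \<Rightarrow> ('v, 'n, 'm) wtraj \<Rightarrow> (real \<Rightarrow> ('v, 'n) mult) \<Rightarrow> real^'n \<Rightarrow>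
     (real \<Rightarrow> real^'n) \<Rightarrow> bool" where
  "is_argz P w \<mu> xk z \<longleftrightarrow>
     z \<in> ztrajs P \<and> (\<forall>z'\<in>ztrajs P. auglag P w z \<mu> xk \<le> auglag P w z' \<mu> xk)"

definition mu_update ::
    "('v::finite, 'n::finite, 'm::finite) dmpc \<Rightarrow> real^'n \<Rightarrow> ('v, 'n, 'm) wtraj \<Rightarrow> (real \<Rightarrow> real^'n) \<Rightarrow>
     (real \<Rightarrow> ('v, 'n) mult) \<Rightarrow> real \<Rightarrow> ('v, 'n) mult" where
  "mu_update P xk w z \<mu> \<tau> =
     (fst (\<mu> \<tau>) + pen P *\<^sub>R (z \<tau> - dresp P w xk \<tau>),
      \<chi> i. snd (\<mu> \<tau>) $ i + pen P *\<^sub>R nblk P i (z \<tau> - snd w \<tau> $ i))"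

type_synonym ('v, 'n) zmu = "(real \<Rightarrow> real^'n) \<times> (real \<Rightarrow> ('v, 'n) mult)"

text \<open>\<open>admm P xk s q\<close> is the pair \<open>(z^q, mu^q)\<close> of iterates for the state \<open>xk\<close>, started at
  \<open>s = (z^0, mu^0)\<close>; \<open>admm_w P xk s q\<close> is \<open>w^q\<close> (meaningful for \<open>q >= 1\<close>).\<close>
primrec admm ::
    "('v::finite, 'n::finite, 'm::finite) dmpc \<Rightarrow> real^'n \<Rightarrow> ('v, 'n) zmu \<Rightarrow> nat \<Rightarrow> ('v, 'n) zmu" where
  "admm P xk s 0 = s"
| "admm P xk s (Suc q) =
     (let z = fst (admm P xk s q); \<mu> = snd (admm P xk s q);
          w = argw P z \<mu> xk; z' = argz P w \<mu> xk
      in (z', mu_update P xk w z' \<mu>))"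

definition admm_w ::
    "('v::finite, 'n::finite, 'm::finite) dmpc \<Rightarrow> real^'n \<Rightarrow> ('v, 'n) zmu \<Rightarrow> nat \<Rightarrow> ('v, 'n, 'm) wtraj" where
  "admm_w P xk s q = argw P (fst (admm P xk s (q - 1))) (snd (admm P xk s (q - 1))) xk"

definition stops ::
    "('v::finite, 'n::finite, 'm::finite) dmpc \<Rightarrow> real \<Rightarrow> real^'n \<Rightarrow> ('v, 'n) zmu \<Rightarrow> nat \<Rightarrow> bool" where
  "stops P d xk s q \<longleftrightarrow>
     1 \<le> q \<and>
     (let z = fst (admm P xk s q); z' = fst (admm P xk s (q - 1));
          \<mu> = snd (admm P xk s q); \<mu>' = snd (admm P xk s (q - 1))
      in \<forall>i. supnorm (hor P) (\<lambda>\<tau>.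
               (sblk P i (z \<tau> - z' \<tau>),
                sblk P i (fst (\<mu> \<tau>) - fst (\<mu>' \<tau>)),
                nblk P i (snd (\<mu> \<tau>) $ i - snd (\<mu>' \<tau>) $ i)))
             \<le> d * norm (sblk P i xk))"

definition stop_index ::
    "('v::finite, 'n::finite, 'm::finite) dmpc \<Rightarrow> real \<Rightarrow> real^'n \<Rightarrow> ('v, 'n) zmu \<Rightarrow> nat" where
  "stop_index P d xk s = (LEAST q. stops P d xk s q)"

definition xF ::
    "('v::finite, 'n::finite, 'm::finite) dmpc \<Rightarrow> real^'n \<Rightarrow> ('v, 'n) zmu \<Rightarrow> nat \<Rightarrow> real \<Rightarrow> real^'n" where
  "xF P xk s q = resp P (fst (admm_w P xk s q)) xk"

text \<open>Closed loop with stopping constant \<open>d\<close>: the plant state at \<open>t_k\<close> together with the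
  (warm-started) initial trajectories of MPC step \<open>k\<close>.\<close>
primrec loop ::
    "('v::finite, 'n::finite, 'm::finite) dmpc \<Rightarrow> real \<Rightarrow> real^'n \<Rightarrow> nat \<Rightarrow> (real^'n) \<times> ('v, 'n) zmu" where
  "loop P d x0 0 = (x0, (zinit P x0, muinit P x0))"
| "loop P d x0 (Suc k) =
     (let xk = fst (loop P d x0 k); s = snd (loop P d x0 k); q = stop_index P d xk s
      in (xF P xk s q (samp P), admm P xk s q))"

definition state_at :: "('v::finite, 'n::finite, 'm::finite) dmpc \<Rightarrow> real \<Rightarrow> real^'n \<Rightarrow> nat \<Rightarrow> real^'n" where
  "state_at P d x0 k = fst (loop P d x0 k)"

definition start_at :: "('v::finite, 'n::finite, 'm::finite) dmpc \<Rightarrow> real \<Rightarrow> real^'n \<Rightarrow> nat \<Rightarrow> ('v, 'n) zmu" where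
  "start_at P d x0 k = snd (loop P d x0 k)"

definition q_at :: "('v::finite, 'n::finite, 'm::finite) dmpc \<Rightarrow> real \<Rightarrow> real^'n \<Rightarrow> nat \<Rightarrow> nat" where
  "q_at P d x0 k = stop_index P d (state_at P d x0 k) (start_at P d x0 k)"

definition iter_w :: "('v::finite, 'n::finite, 'm::finite) dmpc \<Rightarrow> real \<Rightarrow> real^'n \<Rightarrow> nat \<Rightarrow> nat \<Rightarrow> ('v, 'n, 'm) wtraj" where
  "iter_w P d x0 k q = admm_w P (state_at P d x0 k) (start_at P d x0 k) q"

definition iter_x :: "('v::finite, 'n::finite, 'm::finite) dmpc \<Rightarrow> real \<Rightarrow> real^'n \<Rightarrow> nat \<Rightarrow> nat \<Rightarrow> real \<Rightarrow> real^'n" where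
  "iter_x P d x0 k q = dresp P (iter_w P d x0 k q) (state_at P d x0 k)"

definition iter_z :: "('v::finite, 'n::finite, 'm::finite) dmpc \<Rightarrow> real \<Rightarrow> real^'n \<Rightarrow> nat \<Rightarrow> nat \<Rightarrow> real \<Rightarrow> real^'n" where
  "iter_z P d x0 k q = fst (admm P (state_at P d x0 k) (start_at P d x0 k) q)"

definition iter_mu :: "('v::finite, 'n::finite, 'm::finite) dmpc \<Rightarrow> real \<Rightarrow> real^'n \<Rightarrow> nat \<Rightarrow> nat \<Rightarrow> real \<Rightarrow> ('v, 'n) mult" where
  "iter_mu P d x0 k q = snd (admm P (state_at P d x0 k) (start_at P d x0 k) q)"

definition xF_at :: "('v::finite, 'n::finite, 'm::finite) dmpc \<Rightarrow> real \<Rightarrow> real^'n \<Rightarrow> nat \<Rightarrow> real \<Rightarrow> real^'n" where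
  "xF_at P d x0 k = xF P (state_at P d x0 k) (start_at P d x0 k) (q_at P d x0 k)"

definition err_norm :: "('v::finite, 'n::finite, 'm::finite) dmpc \<Rightarrow> real \<Rightarrow> real^'n \<Rightarrow> nat \<Rightarrow> real" where
  "err_norm P d x0 k = supnorm (hor P) (\<lambda>\<tau>. xF_at P d x0 k \<tau> - optx P (state_at P d x0 k) \<tau>)"

definition plant_state :: "('v::finite, 'n::finite, 'm::finite) dmpc \<Rightarrow> real \<Rightarrow> real^'n \<Rightarrow> real \<Rightarrow> real^'n" where
  "plant_state P d x0 t =
     (let k = nat \<lfloor>t / samp P\<rfloor> in xF_at P d x0 k (t - real k * samp P))"

text \<open>The stopping criterion is met in MPC step \<open>k\<close>, i.e. \<open>q_k\<close> exists. It can fail for a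
  convergent iteration when some block of \<open>x_k\<close> vanishes, since the tolerance of that agent is 0;
  the closed loop is defined as long as it holds.\<close>
definition halts :: "('v::finite, 'n::finite, 'm::finite) dmpc \<Rightarrow> real \<Rightarrow> real^'n \<Rightarrow> nat \<Rightarrow> bool" where
  "halts P d x0 k \<longleftrightarrow> (\<exists>q. stops P d (state_at P d x0 k) (start_at P d x0 k) q)"

text \<open>MPC step \<open>k\<close> is reached by the closed loop from \<open>x0\<close> with stopping constant \<open>d\<close>, and its state
  lies in the level set of \<open>\<alpha>\<close>. The ADMM-related hypotheses are imposed on these steps.\<close>
definition active :: "('v::finite, 'n::finite, 'm::finite) dmpc \<Rightarrow> real \<Rightarrow> real \<Rightarrow> real^'n \<Rightarrow> nat \<Rightarrow> bool" where
  "active P \<alpha> d x0 k \<longleftrightarrow>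
     x0 \<in> level P \<alpha> \<and> (\<forall>j<k. halts P d x0 j) \<and> state_at P d x0 k \<in> level P \<alpha>"

section \<open>Standing assumptions\<close>

definition standing :: "('v::finite, 'n::finite, 'm::finite) dmpc \<Rightarrow> real \<Rightarrow> real \<Rightarrow> real \<Rightarrow> real \<Rightarrow> bool" where
  "standing P ml Ml mV MV \<longleftrightarrow>
     0 < hor P \<and> 0 < samp P \<and> samp P \<le> hor P \<and> 0 < pen P \<and>
     0 < ml \<and> 0 < Ml \<and> 0 \<le> mV \<and> 0 \<le> MV \<and>
     (\<forall>x u. ml * ((norm x)\<^sup>2 + (norm u)\<^sup>2) \<le> lcost P x u \<and>
            lcost P x u \<le> Ml * ((norm x)\<^sup>2 + (norm u)\<^sup>2)) \<and>
     (\<forall>x. mV * (norm x)\<^sup>2 \<le> Vcost P x \<and> Vcost P x \<le> MV * (norm x)\<^sup>2) \<and>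
     (\<forall>i. dyn P i 0 0 0 = 0) \<and>
     (\<forall>i. C1_map (\<lambda>(x, u, v). dyn P i x u v)) \<and>
     (\<forall>i. C1_map (tcost P i)) \<and>
     (\<forall>i. C1_map (\<lambda>(x, u). scost P i x u)) \<and>
     (\<forall>i. compact (inset P i) \<and> convex (inset P i) \<and> (\<forall>u\<in>inset P i. iblk P i u = u)) \<and>
     (\<forall>x0. \<forall>u\<in>controls P. \<exists>x. is_resp P u x0 x \<and> bounded (x ` {0..hor P})) \<and>
     (\<forall>x0. optu P x0 \<in> controls P \<and> (\<forall>u\<in>controls P. Jcost P (optu P x0) x0 \<le> Jcost P u x0))"

definition admm_exact :: "('v::finite, 'n::finite, 'm::finite) dmpc \<Rightarrow> real \<Rightarrow> real \<Rightarrow> bool" where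
  "admm_exact P \<alpha> dmax \<longleftrightarrow>
     (\<forall>d x0 k q. 0 < d \<longrightarrow> d \<le> dmax \<longrightarrow> active P \<alpha> d x0 k \<longrightarrow> 1 \<le> q \<longrightarrow>
        is_argw P (iter_z P d x0 k (q - 1)) (iter_mu P d x0 k (q - 1)) (state_at P d x0 k)
          (iter_w P d x0 k q) \<and>
        is_argz P (iter_w P d x0 k q) (iter_mu P d x0 k (q - 1)) (state_at P d x0 k)
          (iter_z P d x0 k q))"

text \<open>The defining relations of the feedback laws \<open>kappa*\<close> and \<open>kappa\<close>.\<close>
definition feedback_laws :: "('v::finite, 'n::finite, 'm::finite) dmpc \<Rightarrow> real \<Rightarrow> real \<Rightarrow> bool" where
  "feedback_laws P \<alpha> dmax \<longleftrightarrow>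
     (\<forall>xk\<in>level P \<alpha>. \<forall>\<tau>\<in>{0..hor P}. optu P xk \<tau> = kopt P (optx P xk \<tau>) xk) \<and>
     (\<forall>xk\<in>level P \<alpha>. \<forall>x. kopt P x xk = klaw P x (optz P xk) (optmu P xk) xk) \<and>
     (\<forall>d x0 k. 0 < d \<longrightarrow> d \<le> dmax \<longrightarrow> active P \<alpha> d x0 k \<longrightarrow> halts P d x0 k \<longrightarrow>
        (let q = q_at P d x0 k in
         \<forall>\<tau>\<in>{0..hor P}.
           fst (iter_w P d x0 k q) \<tau> =
             klaw P (iter_x P d x0 k q \<tau>) (iter_z P d x0 k (q - 1)) (iter_mu P d x0 k (q - 1))
               (state_at P d x0 k)))"

text \<open>\<open>Lf\<close>, \<open>Lks\<close>, \<open>Lk\<close> are Lipschitz constants of \<open>f\<close>, \<open>kappa*\<close>, \<open>kappa\<close> on compact sets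
  (\<open>X\<close> for states, \<open>Y\<close> for local copies, \<open>U\<close> for inputs) that contain the trajectories occurring
  in the scheme for states \<open>x_k\<close> in the level set, and on the neighbourhoods in which the ADMM
  trajectories evolve.\<close>
definition lipschitz_consts ::
    "('v::finite, 'n::finite, 'm::finite) dmpc \<Rightarrow> real \<Rightarrow> real \<Rightarrow> real \<Rightarrow> real \<Rightarrow>
     (real^'n) set \<Rightarrow> (real^'n^'v) set \<Rightarrow> real \<Rightarrow> real \<Rightarrow> real \<Rightarrow> bool" where
  "lipschitz_consts P \<alpha> dmax \<sigma>z \<sigma>\<mu> X Y Lf Lks Lk \<longleftrightarrow>
     0 < Lf \<and> 0 < Lks \<and> 0 < Lk \<and> compact X \<and> compact Y \<and> copy P ` X \<subseteq> Y \<and>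
     (\<forall>xk\<in>level P \<alpha>. \<forall>\<tau>\<in>{0..hor P}. optx P xk \<tau> \<in> X) \<and>
     (\<forall>d x0 k. 0 < d \<longrightarrow> d \<le> dmax \<longrightarrow> active P \<alpha> d x0 k \<longrightarrow> halts P d x0 k \<longrightarrow>
        (let q = q_at P d x0 k in
         \<forall>\<tau>\<in>{0..hor P}. iter_x P d x0 k q \<tau> \<in> X \<and> snd (iter_w P d x0 k q) \<tau> \<in> Y \<and>
                        xF_at P d x0 k \<tau> \<in> X)) \<and>
     (\<forall>x\<in>X. \<forall>x'\<in>X. \<forall>u\<in>Uset P. \<forall>u'\<in>Uset P. \<forall>v\<in>Y. \<forall>v'\<in>Y.
        norm (fdec P x u v - fdec P x' u' v') \<le> Lf * (norm (x - x') + norm (u - u') + norm (v - v'))) \<and>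
     (\<forall>x\<in>X. \<forall>u\<in>Uset P. norm (Fdyn P x u) \<le> Lf * (norm x + norm u)) \<and>
     (\<forall>xk\<in>level P \<alpha>. \<forall>x\<in>X. \<forall>x'\<in>X. norm (kopt P x xk - kopt P x' xk) \<le> Lks * norm (x - x')) \<and>
     (\<forall>xk\<in>level P \<alpha>. \<forall>x\<in>X. norm (kopt P x xk) \<le> Lks * norm x) \<and>
     (\<forall>xk\<in>level P \<alpha>. \<forall>x\<in>X. \<forall>x'\<in>X.
        \<forall>z\<in>Linf_nbhd (hor P) (ztrajs P) (optz P ` level P \<alpha>) \<sigma>z.
        \<forall>z'\<in>Linf_nbhd (hor P) (ztrajs P) (optz P ` level P \<alpha>) \<sigma>z.
        \<forall>\<mu>\<in>Linf_nbhd (hor P) (mutrajs P) (optmu P ` level P \<alpha>) \<sigma>\<mu>.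
        \<forall>\<mu>'\<in>Linf_nbhd (hor P) (mutrajs P) (optmu P ` level P \<alpha>) \<sigma>\<mu>.
          norm (klaw P x z \<mu> xk - klaw P x' z' \<mu>' xk)
            \<le> Lk * (norm (x - x') + supnorm (hor P) (\<lambda>\<tau>. z \<tau> - z' \<tau>)
                      + supnorm (hor P) (\<lambda>\<tau>. \<mu> \<tau> - \<mu>' \<tau>)))"

section \<open>The constants entering the size of the domain of attraction\<close>

definition Lhat :: "real \<Rightarrow> real \<Rightarrow> real" where
  "Lhat Lf Lks = Lf * (1 + Lks)"

definition mJ :: "real \<Rightarrow> real \<Rightarrow> real \<Rightarrow> real" where
  "mJ ml L T = ml / (2 * L) * (1 - exp (- 2 * L * T))"

definition MJ :: "real \<Rightarrow> real \<Rightarrow> real \<Rightarrow> real \<Rightarrow> real \<Rightarrow> real" where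
  "MJ MV Ml Lks L T =
     MV * exp (2 * L * T) + Ml / (2 * L) * (1 + Lks\<^sup>2) * (exp (2 * L * T) - 1)"

definition Dconst :: "('v::finite, 'n::finite, 'm::finite) dmpc \<Rightarrow> real \<Rightarrow> real \<Rightarrow> real \<Rightarrow> real" where
  "Dconst P Lf Lk C =
     (let N = real CARD('v); sp = sqrt (real (pdim P)); T = hor P; \<rho> = pen P;
          K1 = (Lf * (2 * sp / \<rho>) + 2 * Lk / (1 - C)) * N;
          K2 = Lf * (1 + sp + Lk)
      in 2 * sp / \<rho> * N * Lf * T * exp (Lf * (1 + sp) * T) + K1 * T * exp (K2 * T))"

definition alpha_hat ::
    "('v::finite, 'n::finite, 'm::finite) dmpc \<Rightarrow> real \<Rightarrow> real \<Rightarrow> real \<Rightarrow> real \<Rightarrow> real \<Rightarrow> real \<Rightarrow> real \<Rightarrow> real \<Rightarrow>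
     real \<Rightarrow> real" where
  "alpha_hat P ml Ml MV Lf Lks Lk C \<alpha> d =
     (let L = Lhat Lf Lks; T = hor P in
      mJ ml L T * \<alpha> /
        (MJ MV Ml Lks L T * (exp (L * samp P) + Dconst P Lf Lk C * d)\<^sup>2))"

end

theory Submission
  imports Defs
begin

text \<open>
  The optimal cost \<open>J\<close> is a Lyapunov function whose decrease survives the inexact
  distributed optimization, because every quantity involved is quadratic in the current state \<open>a\<close>.

  The optimal trajectory \<open>x*\<close> from \<open>a\<close> satisfies \<open>J (x*(samp)) \<le> J a - int l\<close>, where \<open>int l\<close> is the
  integral of the stage cost over one sampling interval. This is the usual argument without terminal
  constraint: if \<open>J a \<le> \<alpha>\<close>, then \<open>x*\<close> ends in the terminal set (\<open>optimal_ends_in_terminal\<close>), where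
  the terminal law extends it at no extra cost (\<open>optimal_cost_decrease\<close>). The terminal law is an arbitrary
  function, so it is used only through piecewise constant inputs that sample it (\<open>hold_step\<close>), at the
  price of an arbitrarily small loss. Gronwall estimates give \<open>m |a|^2 \<le> int l\<close> and
  \<open>J a \<le> M |a|^2\<close> (\<open>J_lower\<close>, \<open>J_upper\<close>), so the decrease is by a fixed fraction of \<open>J a\<close>.

  The plant state deviates from \<open>x*\<close> by at most \<open>D d |a|\<close> (\<open>closed_loop_prediction_error\<close>). The
  stopping criterion makes the last increment of the coordination variables and multipliers of order
  \<open>d |a|\<close>, and linear convergence turns this into a distance to the optimal ones. The multiplier
  increment is the penalty times the consistency violation, so the agents' predicted states are equally
  close to \<open>x*\<close>. The Lipschitz property of the feedback law then bounds the input error, and Gronwall's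
  inequality the error of the plant state.

  As \<open>J\<close> is twice continuously differentiable with minimum \<open>0\<close> at the origin, this deviation changes
  \<open>J\<close> by at most a constant times \<open>d |a|^2\<close>. For small \<open>d\<close> the decrease wins
  (\<open>inexact_decrease\<close>), so \<open>J\<close> contracts by a factor \<open>\<theta> < 1\<close> in every step. In particular the closed
  loop does not leave the level set of \<open>\<alpha>\<close>. It contains that of \<open>alpha_hat\<close> (\<open>alpha_hat_le\<close>), and the three claims
  follow by induction over the steps and the bounds above.
\<close>

section \<open>Continuously differentiable maps and an integral Gronwall inequality\<close>

lemma C1_map_continuous: "C1_map g \<Longrightarrow> continuous_on UNIV g"
  unfolding C1_map_def by (metis has_derivative_continuous continuous_at_imp_continuous_on)

lemma C1_map_compose_linear:
  assumes "C1_map g" "bounded_linear A"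
  shows "C1_map (\<lambda>x. g (A x))"
proof -
  obtain g' where g': "\<And>x. (g has_derivative blinfun_apply (g' x)) (at x)" "continuous_on UNIV g'"
    using assms(1) unfolding C1_map_def by blast
  have "((\<lambda>x. g (A x)) has_derivative blinfun_apply (g' (A x) o\<^sub>L Blinfun A)) (at x)" for x
    using has_derivative_compose[OF bounded_linear_imp_has_derivative[OF assms(2)] g'(1)[of "A x"]]
    by (rule has_derivative_eq_rhs) (simp add: fun_eq_iff bounded_linear_Blinfun_apply[OF assms(2)])
  moreover have "continuous_on UNIV (\<lambda>x. g' (A x) o\<^sub>L Blinfun A)"
    by (intro continuous_intros continuous_on_compose2[OF g'(2)] linear_continuous_on assms(2)) auto
  ultimately show ?thesis
    unfolding C1_map_def by (intro exI[of _ "\<lambda>x. g' (A x) o\<^sub>L Blinfun A"]) simp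
qed

lemma C1_map_linear_compose:
  assumes "C1_map g" "bounded_linear B"
  shows "C1_map (\<lambda>x. B (g x))"
proof -
  obtain g' where g': "\<And>x. (g has_derivative blinfun_apply (g' x)) (at x)" "continuous_on UNIV g'"
    using assms(1) unfolding C1_map_def by blast
  have "((\<lambda>x. B (g x)) has_derivative blinfun_apply (Blinfun B o\<^sub>L g' x)) (at x)" for x
    using bounded_linear.has_derivative[OF assms(2) g'(1)[of x]]
    by (rule has_derivative_eq_rhs) (simp add: fun_eq_iff bounded_linear_Blinfun_apply[OF assms(2)])
  moreover have "continuous_on UNIV (\<lambda>x. Blinfun B o\<^sub>L g' x)"
    by (intro continuous_intros g'(2))
  ultimately show ?thesis
    unfolding C1_map_def by (intro exI[of _ "\<lambda>x. Blinfun B o\<^sub>L g' x"]) simp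
qed

lemma C1_map_add: assumes "C1_map g" "C1_map h" shows "C1_map (\<lambda>x. g x + h x)"
proof -
  obtain g' h' where *: "\<And>x. (g has_derivative blinfun_apply (g' x)) (at x)" "continuous_on UNIV g'"
    "\<And>x. (h has_derivative blinfun_apply (h' x)) (at x)" "continuous_on UNIV h'"
    using assms unfolding C1_map_def by blast
  have "((\<lambda>x. g x + h x) has_derivative blinfun_apply (g' x + h' x)) (at x)" for x
    using has_derivative_add[OF *(1)[of x] *(3)[of x]]
    by (rule has_derivative_eq_rhs) (simp add: fun_eq_iff blinfun.add_left)
  then show ?thesis
    unfolding C1_map_def using *(2,4) by (intro exI[of _ "\<lambda>x. g' x + h' x"]) (auto intro!: continuous_intros)
qed

lemma C1_map_zero: "C1_map (\<lambda>x. 0)"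
  unfolding C1_map_def by (rule exI[of _ "\<lambda>x. 0"]) (auto simp: zero_blinfun.rep_eq)

lemma C1_map_sum: "finite I \<Longrightarrow> (\<And>i. i \<in> I \<Longrightarrow> C1_map (g i)) \<Longrightarrow> C1_map (\<lambda>x. \<Sum>i\<in>I. g i x)"
  by (induction I rule: finite_induct) (auto intro!: C1_map_zero C1_map_add)

lemma compact_image_norm_bound:
  assumes "compact S" "continuous_on S f"
  obtains B where "0 < B" "\<And>x. x \<in> S \<Longrightarrow> norm (f x) \<le> B"
proof -
  have "bounded (f ` S)" by (rule compact_imp_bounded[OF compact_continuous_image[OF assms(2,1)]])
  then obtain B where B: "0 < B \<and> (\<forall>y\<in>f ` S. norm y \<le> B)"
    unfolding bounded_pos by (elim exE)
  show ?thesis by (rule that[of B]) (use B in simp_all)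
qed

lemma C1_map_Lipschitz_cball:
  fixes g :: "'a::euclidean_space \<Rightarrow> 'b::real_normed_vector"
  assumes "C1_map g"
  obtains B where "0 < B" "\<And>x y. norm x \<le> R \<Longrightarrow> norm y \<le> R \<Longrightarrow> norm (g x - g y) \<le> B * norm (x - y)"
proof -
  obtain g' where g': "\<And>x. (g has_derivative blinfun_apply (g' x)) (at x)" "continuous_on UNIV g'"
    using assms unfolding C1_map_def by blast
  obtain B where B: "0 < B" "\<And>x. x \<in> cball 0 R \<Longrightarrow> norm (g' x) \<le> B"
    using compact_image_norm_bound[OF compact_cball[of 0 R] continuous_on_subset[OF g'(2) subset_UNIV]] by blast
  have "norm (g x - g y) \<le> B * norm (x - y)" if "norm x \<le> R" "norm y \<le> R" for x y
    by (rule differentiable_bound[of "cball 0 R" g "\<lambda>x. blinfun_apply (g' x)"])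
       (use that B in \<open>auto simp flip: norm_blinfun.rep_eq intro: has_derivative_at_withinI[OF g'(1)]\<close>)
  with B(1) show ?thesis using that by blast
qed

lemma gronwall_integral:
  fixes \<phi> :: "real \<Rightarrow> real"
  assumes cont: "continuous_on {0..s} \<phi>" and t: "t \<in> {0..s}" and L: "0 \<le> L"
    and le: "\<And>t. t \<in> {0..s} \<Longrightarrow> \<phi> t \<le> c + L * integral {0..t} \<phi>"
  shows "\<phi> t \<le> c * exp (L * t)"
proof -
  define h where "h t = (c + L * integral {0..t} \<phi>) * exp (- L * t)" for t
  define h' where "h' t = L * (\<phi> t - (c + L * integral {0..t} \<phi>)) * exp (- L * t)" for t
  have I: "((\<lambda>t. integral {0..t} \<phi>) has_real_derivative \<phi> r) (at r within {0..s})" if "r \<in> {0..s}" for r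
    using integral_has_real_derivative[OF cont that] .
  have D: "(h has_real_derivative h' r) (at r within {0..s})" if "r \<in> {0..s}" for r
    unfolding h_def h'_def by (rule derivative_eq_intros I that refl)+ (simp add: algebra_simps)
  have "h t \<le> h 0"
  proof (rule DERIV_nonpos_imp_decreasing_open[of 0 t h])
    show "0 \<le> t" using t by simp
    show "\<exists>y. DERIV h r :> y \<and> y \<le> 0" if "0 < r" "r < t" for r
    proof (intro exI conjI)
      have r: "r \<in> {0..s}" using that t by auto
      show "DERIV h r :> h' r"
        using D[OF r] that t by (auto simp: at_within_Icc_at)
      show "h' r \<le> 0"
        unfolding h'_def using le[OF r] L by (intro mult_nonpos_nonneg mult_nonneg_nonpos) auto
    qed
    have "continuous_on {0..s} h"
      by (meson D DERIV_continuous continuous_on_eq_continuous_within)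
    then show "continuous_on {0..t} h" using t by (auto intro: continuous_on_subset)
  qed
  then have "(c + L * integral {0..t} \<phi>) * exp (- L * t) \<le> c"
    by (simp add: h_def)
  then have "(c + L * integral {0..t} \<phi>) \<le> c * exp (L * t)"
    by (simp add: exp_minus field_simps)
  then show ?thesis using le[OF t] by linarith
qed

section \<open>Processes of a control system\<close>

lemma integrable_continuous_compose:
  fixes x :: "real \<Rightarrow> 'a::euclidean_space" and u :: "real \<Rightarrow> 'b::euclidean_space"
    and g :: "'a \<times> 'b \<Rightarrow> 'c::euclidean_space"
  assumes x: "continuous_on {a..b} x" and u: "u integrable_on {a..b}"
    and U: "u ` {a..b} \<subseteq> U" "compact U" and g: "continuous_on UNIV g"
  shows "(\<lambda>t. g (x t, u t)) integrable_on {a..b}"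
proof -
  have "compact (x ` {a..b} \<times> U)"
    by (intro compact_Times compact_continuous_image[OF x] U compact_Icc)
  then obtain B where B: "\<And>p. p \<in> x ` {a..b} \<times> U \<Longrightarrow> norm (g p) \<le> B"
    using compact_image_norm_bound[OF _ continuous_on_subset[OF g subset_UNIV]] by metis
  have mx: "x \<in> borel_measurable (lebesgue_on {a..b})"
    by (rule continuous_imp_measurable_on_sets_lebesgue[OF x]) auto
  have mu: "u \<in> borel_measurable (lebesgue_on {a..b})"
    by (rule integrable_imp_measurable[OF u])
  have "(\<lambda>t. g (x t, u t)) \<in> borel_measurable (lebesgue_on {a..b})"
    by (rule borel_measurable_continuous_Pair[OF mx mu]) (use g in auto)
  then show ?thesis
    by (rule measurable_bounded_by_integrable_imp_integrable[where g = "\<lambda>_. B"])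
       (use U in \<open>auto intro!: B imageI\<close>)
qed

lemma has_integral_append:
  fixes g h :: "real \<Rightarrow> 'a::banach"
  assumes g: "(g has_integral i) {0..t}" and h: "(h has_integral j) {0..t'}" and t: "0 \<le> t" "0 \<le> t'"
  shows "((\<lambda>q. if q \<le> t then g q else h (q - t)) has_integral (i + j)) {0..t + t'}"
proof (rule has_integral_combine[of 0 t])
  show "((\<lambda>q. if q \<le> t then g q else h (q - t)) has_integral i) {0..t}"
    by (rule has_integral_eq[OF _ g]) auto
  have "((\<lambda>q. h (q - t)) has_integral j) {t..t + t'}"
    using has_integral_shift_real_ivl_iff[of "\<lambda>q. h (q - t)" j t "t + t'" t] h by simp
  then show "((\<lambda>q. if q \<le> t then g q else h (q - t)) has_integral j) {t..t + t'}"
    by (rule has_integral_spike_finite[of "{t}", rotated 2]) auto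
qed (use t in auto)

text \<open>Carrying the state and input together over a variable time span allows processes to be cut and
  concatenated. Inputs with values in a compact set are measurable iff they are integrable, and
  integrability is easier to transport along these operations.\<close>
definition process ::
    "('a::euclidean_space \<Rightarrow> 'b::euclidean_space \<Rightarrow> 'a) \<Rightarrow> 'b set \<Rightarrow> real \<Rightarrow> (real \<Rightarrow> 'a) \<Rightarrow> (real \<Rightarrow> 'b) \<Rightarrow> bool" where
  "process F U s x u \<longleftrightarrow>
     0 \<le> s \<and> u integrable_on {0..s} \<and> u ` {0..s} \<subseteq> U \<and> solves s (\<lambda>r y. F y (u r)) (x 0) x"

locale control_system =
  fixes F :: "'a::euclidean_space \<Rightarrow> 'b::euclidean_space \<Rightarrow> 'a" and U :: "'b set"
    and l :: "'a \<Rightarrow> 'b \<Rightarrow> real"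
  assumes C1_F: "C1_map (\<lambda>(x, u). F x u)"
    and compact_U: "compact U"
    and continuous_l: "continuous_on UNIV (\<lambda>(x, u). l x u)"
begin

abbreviation "proc \<equiv> process F U"

definition run :: "real \<Rightarrow> (real \<Rightarrow> 'a) \<Rightarrow> (real \<Rightarrow> 'b) \<Rightarrow> real" where
  "run s x u = integral {0..s} (\<lambda>t. l (x t) (u t))"

lemma proc_continuous: "proc s x u \<Longrightarrow> continuous_on {0..s} x"
  by (simp add: process_def solves_def)

lemma proc_input: "proc s x u \<Longrightarrow> t \<in> {0..s} \<Longrightarrow> u t \<in> U"
  by (auto simp: process_def)

lemma proc_has_integral:
  "proc s x u \<Longrightarrow> t \<in> {0..s} \<Longrightarrow> ((\<lambda>r. F (x r) (u r)) has_integral (x t - x 0)) {0..t}"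
  by (simp add: process_def solves_def)

lemma proc_integrable:
  assumes "proc s x u" "continuous_on UNIV (\<lambda>(x, u). g x u)"
  shows "(\<lambda>t. (g (x t) (u t) :: 'c::euclidean_space)) integrable_on {0..s}"
  using integrable_continuous_compose[of 0 s x u U "\<lambda>(x, u). g x u"] assms compact_U
  by (auto simp: process_def solves_def)

lemma proc_prefix:
  assumes "proc s x u" "0 \<le> r" "r \<le> s"
  shows "proc r x u"
  using assms unfolding process_def solves_def
  by (auto intro: continuous_on_subset integrable_on_subinterval)

lemma proc_tail:
  assumes p: "proc s x u" and r: "0 \<le> r" "r \<le> s"
  shows "proc (s - r) (\<lambda>t. x (t + r)) (\<lambda>t. u (t + r))" (is "proc _ ?x ?u")
    and "run s x u = run r x u + run (s - r) (\<lambda>t. x (t + r)) (\<lambda>t. u (t + r))"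
proof -
  have sub: "u integrable_on {r..s}"
    using p r unfolding process_def by (auto intro: integrable_on_subinterval)
  have "(?u integrable_on {0..s - r}) = (u integrable_on {r..s})"
    using integrable_shift_real_ivl_iff[of u r r s] by simp
  moreover have "continuous_on {0..s - r} ?x"
    by (rule continuous_on_compose2[OF proc_continuous[OF p]]) (use r in \<open>auto intro!: continuous_intros\<close>)
  moreover have "((\<lambda>q. F (?x q) (?u q)) has_integral ?x t - ?x 0) {0..t}" if "t \<in> {0..s - r}" for t
  proof -
    let ?g = "\<lambda>q. F (x q) (u q)"
    have t: "t + r \<in> {0..s}" "r \<in> {0..s}" "0 \<le> t" using that r by auto
    have i: "?g integrable_on {0..t + r}" using proc_has_integral[OF p t(1)] by blast
    have c: "integral {0..r} ?g + integral {r..t + r} ?g = integral {0..t + r} ?g"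
      by (rule Henstock_Kurzweil_Integration.integral_combine) (use i r t in auto)
    have "integral {r..t + r} ?g = integral {0..t + r} ?g - integral {0..r} ?g"
      by (simp flip: c)
    also have "\<dots> = x (t + r) - x r"
      using integral_unique[OF proc_has_integral[OF p t(1)]] integral_unique[OF proc_has_integral[OF p t(2)]]
      by simp
    finally have e: "integral {r..t + r} ?g = x (t + r) - x r" .
    have "?g integrable_on {r..t + r}"
      by (rule integrable_on_subinterval[OF i]) (use r t in auto)
    then have "(?g has_integral (x (t + r) - x r)) {r..t + r}"
      using e by (metis has_integral_integral)
    then show ?thesis
      using has_integral_shift_real_ivl_iff[of ?g "x (t + r) - x r" r "t + r" r] by simp
  qed
  ultimately show "proc (s - r) ?x ?u"
    using sub p r unfolding process_def solves_def by auto
  let ?c = "\<lambda>t. l (x t) (u t)"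
  have i: "?c integrable_on {0..s}" by (rule proc_integrable[OF p continuous_l])
  have "integral {0..r} ?c + integral {r..s} ?c = integral {0..s} ?c"
    by (rule Henstock_Kurzweil_Integration.integral_combine) (use i r in auto)
  moreover have "integral {0..s - r} (\<lambda>t. ?c (t + r)) = integral {r..s} ?c"
    using integral_shift_real_ivl[of r r s ?c] by simp
  ultimately show "run s x u = run r x u + run (s - r) ?x ?u"
    by (simp add: run_def)
qed

lemma proc_append:
  assumes p: "proc s x u" and q: "proc r y v" and join: "y 0 = x s"
  obtains z w where "proc (s + r) z w" "z 0 = x 0" "z (s + r) = y r"
    "run (s + r) z w = run s x u + run r y v"
proof -
  define z where "z t = (if t \<le> s then x t else y (t - s))" for t
  define w where "w t = (if t \<le> s then u t else v (t - s))" for t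
  have s: "0 \<le> s" and r: "0 \<le> r" using p q by (auto simp: process_def)
  have z1: "t \<le> s \<Longrightarrow> z t = x t" and z2: "s \<le> t \<Longrightarrow> z t = y (t - s)" for t
    using join by (auto simp: z_def)
  have "continuous_on ({0..s} \<union> {s..s + r}) z"
  proof (rule continuous_on_closed_Un)
    show "continuous_on {0..s} z"
      using proc_continuous[OF p] by (rule continuous_on_eq) (auto simp: z1)
    have "continuous_on {s..s + r} (\<lambda>t. y (t - s))"
      by (rule continuous_on_compose2[OF proc_continuous[OF q]]) (auto intro!: continuous_intros)
    then show "continuous_on {s..s + r} z"
      by (rule continuous_on_eq) (auto simp: z2)
  qed auto
  moreover have "{0..s} \<union> {s..s + r} = {0..s + r}" using s r by auto
  ultimately have "continuous_on {0..s + r} z" by simp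
  moreover have "w integrable_on {0..s + r}"
    using has_integral_append[of u "integral {0..s} u" s v "integral {0..r} v" r] p q s r
    unfolding w_def[abs_def] process_def by blast
  moreover have "w ` {0..s + r} \<subseteq> U"
    using proc_input[OF p] proc_input[OF q] by (auto simp: w_def)
  moreover have "((\<lambda>q. F (z q) (w q)) has_integral z t - z 0) {0..t}" if t: "t \<in> {0..s + r}" for t
  proof (cases "t \<le> s")
    case True
    show ?thesis
      by (rule has_integral_eq[where f = "\<lambda>q. F (x q) (u q)"])
         (use proc_has_integral[OF p, of t] t True s in \<open>auto simp: z_def w_def\<close>)
  next
    case False
    have "((\<lambda>q. if q \<le> s then F (x q) (u q) else F (y (q - s)) (v (q - s)))
        has_integral (x s - x 0 + (y (t - s) - y 0))) {0..s + (t - s)}"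
      by (rule has_integral_append) (use proc_has_integral[OF p, of s] proc_has_integral[OF q, of "t - s"] t False s in auto)
    moreover have "(\<lambda>q. if q \<le> s then F (x q) (u q) else F (y (q - s)) (v (q - s))) = (\<lambda>q. F (z q) (w q))"
      by (auto simp: z_def w_def)
    ultimately show ?thesis using False s join by (simp add: z_def)
  qed
  ultimately have "proc (s + r) z w"
    using s r unfolding process_def solves_def by simp
  moreover have "run (s + r) z w = run s x u + run r y v"
  proof -
    have "((\<lambda>q. if q \<le> s then l (x q) (u q) else l (y (q - s)) (v (q - s)))
        has_integral (run s x u + run r y v)) {0..s + r}"
      unfolding run_def
      by (intro has_integral_append integrable_integral proc_integrable[OF p continuous_l] proc_integrable[OF q continuous_l] s r)
    moreover have "(\<lambda>q. if q \<le> s then l (x q) (u q) else l (y (q - s)) (v (q - s))) = (\<lambda>q. l (z q) (w q))"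
      by (auto simp: z_def w_def)
    ultimately show ?thesis by (metis run_def integral_unique)
  qed
  ultimately show ?thesis
    using that[of z w] s r join by (simp add: z1 z2)
qed

lemma F_Lipschitz_on_bounded:
  obtains B where "0 < B"
    "\<And>x y u. norm x \<le> R \<Longrightarrow> norm y \<le> R \<Longrightarrow> u \<in> U \<Longrightarrow> norm (F x u - F y u) \<le> B * norm (x - y)"
proof -
  obtain b where b: "\<And>u. u \<in> U \<Longrightarrow> norm u \<le> b"
    using compact_imp_bounded[OF compact_U] unfolding bounded_iff by blast
  obtain B where B: "0 < B" "\<And>p q. norm p \<le> R + b \<Longrightarrow> norm q \<le> R + b \<Longrightarrow>
      norm ((\<lambda>(x, u). F x u) p - (\<lambda>(x, u). F x u) q) \<le> B * norm (p - q)"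
    using C1_map_Lipschitz_cball[OF C1_F, of "R + b"] by blast
  have "norm (F x u - F y u) \<le> B * norm (x - y)" if "norm x \<le> R" "norm y \<le> R" "u \<in> U" for x y u
    using B(2)[of "(x, u)" "(y, u)"] b[OF that(3)] that norm_Pair_le[of x u] norm_Pair_le[of y u]
    by (simp add: norm_Pair)
  with B(1) show ?thesis using that by blast
qed

text \<open>Gronwall's inequality turns the distance between inputs and the Lipschitz constant of the
  dynamics into a distance between trajectories.\<close>
lemma proc_distance:
  assumes p: "proc s x u" and q: "proc s y v" and eq: "x 0 = y 0" and L: "0 \<le> L"
    and F: "\<And>t. t \<in> {0..s} \<Longrightarrow> norm (F (x t) (u t) - F (y t) (v t)) \<le> L * norm (x t - y t) + c"
    and t: "t \<in> {0..s}"
  shows "norm (x t - y t) \<le> c * s * exp (L * t)"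
proof -
  let ?\<phi> = "\<lambda>t. norm (x t - y t)"
  have c\<phi>: "continuous_on {0..s} ?\<phi>"
    by (rule continuous_on_norm[OF continuous_on_diff[OF proc_continuous[OF p] proc_continuous[OF q]]])
  have c0: "0 \<le> c"
    using order_trans[OF norm_ge_zero F[of 0]] t eq by simp
  show ?thesis
  proof (rule gronwall_integral[OF c\<phi> t L])
    fix t assume t: "t \<in> {0..s}"
    have cont: "continuous_on {0..t} ?\<phi>" using t by (auto intro: continuous_on_subset[OF c\<phi>])
    then have i\<phi>: "?\<phi> integrable_on {0..t}" by (rule integrable_continuous_real)
    have "((\<lambda>r. F (x r) (u r) - F (y r) (v r)) has_integral (x t - y t)) {0..t}"
      using has_integral_diff[OF proc_has_integral[OF p t] proc_has_integral[OF q t]] eq by simp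
    moreover have ib: "((\<lambda>r. L * ?\<phi> r + c) has_integral (L * integral {0..t} ?\<phi> + c * t)) {0..t}"
      using has_integral_add[OF has_integral_mult_right[OF integrable_integral[OF i\<phi>], of L]
          has_integral_const_real[of c 0 t]] t by (simp add: mult.commute)
    ultimately have "?\<phi> t \<le> L * integral {0..t} ?\<phi> + c * t"
      using integral_norm_bound_integral[of "\<lambda>r. F (x r) (u r) - F (y r) (v r)" "{0..t}" "\<lambda>r. L * ?\<phi> r + c"] F t
      by (auto simp: has_integral_iff)
    also have "c * t \<le> c * s" using t c0 by (auto intro: mult_left_mono)
    finally show "?\<phi> t \<le> c * s + L * integral {0..t} ?\<phi>" by simp
  qed
qed

lemma proc_unique:
  assumes p: "proc s x u" and q: "proc s y u" and eq: "x 0 = y 0" and t: "t \<in> {0..s}"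
  shows "x t = y t"
proof -
  have "bounded (x ` {0..s} \<union> y ` {0..s})"
    using proc_continuous[OF p] proc_continuous[OF q]
    by (auto intro!: compact_imp_bounded compact_continuous_image)
  then obtain R where R: "\<And>t. t \<in> {0..s} \<Longrightarrow> norm (x t) \<le> R" "\<And>t. t \<in> {0..s} \<Longrightarrow> norm (y t) \<le> R"
    unfolding bounded_iff by blast
  obtain B where B: "0 < B"
    "\<And>x y u. norm x \<le> R \<Longrightarrow> norm y \<le> R \<Longrightarrow> u \<in> U \<Longrightarrow> norm (F x u - F y u) \<le> B * norm (x - y)"
    using F_Lipschitz_on_bounded[of R] by blast
  have "norm (x t - y t) \<le> 0 * s * exp (B * t)"
    by (rule proc_distance[OF p q eq _ _ t]) (use B R proc_input[OF p] in auto)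
  then show ?thesis by simp
qed

lemma proc_const_input_derivative:
  assumes p: "proc s x (\<lambda>_. u)" and t: "t \<in> {0..s}"
  shows "(x has_vector_derivative F (x t) u) (at t within {0..s})"
proof -
  have "continuous_on {0..s} (\<lambda>t. (\<lambda>(x, u). F x u) (x t, u))"
    by (rule continuous_on_compose2[OF C1_map_continuous[OF C1_F]])
       (auto intro!: continuous_on_Pair proc_continuous[OF p] continuous_on_const)
  then have c: "continuous_on {0..s} (\<lambda>t. F (x t) u)" by simp
  have "((\<lambda>t. x 0 + integral {0..t} (\<lambda>t. F (x t) u)) has_vector_derivative 0 + F (x t) u) (at t within {0..s})"
    by (rule has_vector_derivative_add[OF has_vector_derivative_const integral_has_vector_derivative[OF c t]])
  then show ?thesis
    unfolding add_0
  proof (rule has_vector_derivative_transform[OF t, rotated])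
    show "x r = x 0 + integral {0..r} (\<lambda>t. F (x t) u)" if "r \<in> {0..s}" for r
      using proc_has_integral[OF p that] by (simp add: has_integral_iff)
  qed
qed

lemma growth:
  assumes p: "proc s x u" and L: "0 \<le> L"
    and F: "\<And>t. t \<in> {0..s} \<Longrightarrow> norm (F (x t) (u t)) \<le> L * norm (x t)" and t: "t \<in> {0..s}"
  shows "norm (x t - x 0) \<le> L * t * norm (x 0) * exp (L * s)" "norm (x t) \<le> norm (x 0) * exp (L * t)"
proof -
  let ?\<phi> = "\<lambda>t. norm (x t)"
  have c\<phi>: "continuous_on {0..s} ?\<phi>"
    by (rule continuous_on_norm[OF proc_continuous[OF p]])
  have i\<phi>: "?\<phi> integrable_on {0..t}" if "t \<in> {0..s}" for t
    by (rule integrable_continuous_real[OF continuous_on_subset[OF c\<phi>]]) (use that in auto)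
  have diff: "norm (x t - x 0) \<le> L * integral {0..t} ?\<phi>" if t: "t \<in> {0..s}" for t
  proof -
    have "norm (integral {0..t} (\<lambda>r. F (x r) (u r))) \<le> integral {0..t} (\<lambda>r. L * ?\<phi> r)"
      by (rule integral_norm_bound_integral)
         (use proc_has_integral[OF p t] i\<phi>[OF t] F t in \<open>auto intro: integrable_on_mult_right\<close>)
    then show ?thesis
      using proc_has_integral[OF p t] by (simp add: has_integral_iff)
  qed
  have g: "norm (x t) \<le> norm (x 0) * exp (L * t)" if t: "t \<in> {0..s}" for t
  proof (rule gronwall_integral[OF c\<phi> t L])
    show "norm (x t) \<le> norm (x 0) + L * integral {0..t} ?\<phi>" if "t \<in> {0..s}" for t
      using diff[OF that] norm_triangle_sub[of "x t" "x 0"] by simp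
  qed
  have "integral {0..t} ?\<phi> \<le> integral {0..t} (\<lambda>_. norm (x 0) * exp (L * s))"
  proof (rule integral_le[OF i\<phi>[OF t]])
    show "norm (x r) \<le> norm (x 0) * exp (L * s)" if "r \<in> {0..t}" for r
      using g[of r] that t L by (auto intro!: order_trans[OF g[of r]] mult_left_mono)
  qed auto
  also have "\<dots> = t * norm (x 0) * exp (L * s)" using t by simp
  finally have "L * integral {0..t} ?\<phi> \<le> L * (t * norm (x 0) * exp (L * s))"
    using L by (rule mult_left_mono)
  with diff[OF t] show "norm (x t - x 0) \<le> L * t * norm (x 0) * exp (L * s)"
    by (simp add: mult.assoc)
  show "norm (x t) \<le> norm (x 0) * exp (L * t)" by (rule g[OF t])
qed

end

section \<open>Decrease of the optimal cost along optimal trajectories\<close>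

text \<open>The optimal control problem enters only through a function \<open>J\<close> that is a lower bound for the cost
  of all processes and is attained by the processes \<open>(xo a, uo a)\<close>; \<open>\<kappa>\<close> is the terminal law.\<close>
locale mpc_problem = control_system F U l
  for F :: "'a::euclidean_space \<Rightarrow> 'b::euclidean_space \<Rightarrow> 'a" and U and l +
  fixes V :: "'a \<Rightarrow> real" and V' :: "'a \<Rightarrow> 'a \<Rightarrow>\<^sub>L real"
    and T \<beta> ml Ml MV :: real
    and \<kappa> :: "'a \<Rightarrow> 'b" and J :: "'a \<Rightarrow> real" and xo :: "'a \<Rightarrow> real \<Rightarrow> 'a" and uo :: "'a \<Rightarrow> real \<Rightarrow> 'b"
  assumes T: "0 < T" and \<beta>: "0 \<le> \<beta>" and ml: "0 < ml" and MV: "0 < MV"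
    and F_0: "F 0 0 = 0"
    and V_derivative: "\<And>x. (V has_derivative blinfun_apply (V' x)) (at x)"
    and V'_continuous: "continuous_on UNIV V'"
    and V_nonneg: "\<And>x. 0 \<le> V x" and V_le: "\<And>x. V x \<le> MV * (norm x)\<^sup>2"
    and l_ge: "\<And>x u. ml * ((norm x)\<^sup>2 + (norm u)\<^sup>2) \<le> l x u"
    and l_le: "\<And>x u. l x u \<le> Ml * ((norm x)\<^sup>2 + (norm u)\<^sup>2)"
    and const_response: "\<And>a u. u \<in> U \<Longrightarrow> \<exists>x. process F U T x (\<lambda>_. u) \<and> x 0 = a"
    and compact_terminal: "compact {x. V x \<le> \<beta>}"
    and \<kappa>_U: "\<And>x. V x \<le> \<beta> \<Longrightarrow> \<kappa> x \<in> U"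
    and \<kappa>_decrease: "\<And>x. V x \<le> \<beta> \<Longrightarrow> V' x (F x (\<kappa> x)) + l x (\<kappa> x) \<le> 0"
    and J_le: "\<And>x u. process F U T x u \<Longrightarrow> J (x 0) \<le> V (x T) + integral {0..T} (\<lambda>t. l (x t) (u t))"
    and opt_proc: "\<And>a. process F U T (xo a) (uo a)" and opt_start: "\<And>a. xo a 0 = a"
    and opt_cost: "\<And>a. J a = V (xo a T) + integral {0..T} (\<lambda>t. l (xo a t) (uo a t))"
begin

lemma l_ge_state: "ml * (norm x)\<^sup>2 \<le> l x u"
  using l_ge[of x u] ml by (smt (verit) mult_left_mono zero_le_power2)

lemma l_nonneg: "0 \<le> l x u"
  using l_ge_state[of x u] ml by (smt (verit) mult_nonneg_nonneg zero_le_power2)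

lemma run_nonneg: "proc s x u \<Longrightarrow> 0 \<le> run s x u"
  unfolding run_def by (rule integral_nonneg) (auto intro: proc_integrable[OF _ continuous_l] l_nonneg)

lemma V_continuous: "continuous_on UNIV V"
  by (auto intro!: continuous_at_imp_continuous_on has_derivative_continuous[OF V_derivative])

lemma run_ge_const:
  assumes p: "proc s x u" and c: "\<And>t. t \<in> {0..s} \<Longrightarrow> c \<le> l (x t) (u t)"
  shows "s * c \<le> run s x u"
proof -
  have "integral {0..s} (\<lambda>_. c) \<le> run s x u"
    unfolding run_def by (rule integral_le[OF integrable_const_ivl proc_integrable[OF p continuous_l]]) (rule c)
  then show ?thesis using p by (simp add: process_def)
qed

text \<open>Where the nonnegative function \<open>V\<close> vanishes it is minimal, so its derivative vanishes and the
  decrease condition leaves no room for a positive stage cost.\<close>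
lemma V_zero:
  assumes "V x = 0"
  shows "x = 0" "\<kappa> x = 0"
proof -
  have "V' x y = 0" for y
    using differential_zero_maxmin[of x UNIV "V" "blinfun_apply (V' x)"] V_derivative V_nonneg assms
    by (auto simp: fun_eq_iff)
  then have "l x (\<kappa> x) \<le> 0" using \<kappa>_decrease[of x] assms \<beta> by simp
  then have "(norm x)\<^sup>2 + (norm (\<kappa> x))\<^sup>2 \<le> 0"
    using l_ge[of x "\<kappa> x"] ml by (meson dual_order.trans mult_le_0_iff not_less)
  then have "x = 0 \<and> \<kappa> x = 0" unfolding sum_power2_le_zero_iff norm_eq_zero .
  then show "x = 0" "\<kappa> x = 0" by blast+
qed

lemma V_0: "V 0 = 0" using V_nonneg[of 0] V_le[of 0] by simp

lemma zero_U: "0 \<in> U"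
  using \<kappa>_U[of 0] V_zero(2)[OF V_0] V_0 \<beta> by simp

lemma proc_zero: "0 \<le> s \<Longrightarrow> proc s (\<lambda>_. 0) (\<lambda>_. 0)"
  using zero_U by (auto simp: process_def solves_def F_0)

lemma run_zero: "run s (\<lambda>_. 0) (\<lambda>_. 0) = 0"
  using l_le[of 0 0] l_nonneg[of 0 0] by (simp add: run_def)

text \<open>The terminal law \<open>\<kappa>\<close> need not be continuous, so the equation \<open>x' = F x (\<kappa> x)\<close> may have no solution;
  its value is therefore held constant over short time intervals. By compactness of the terminal set the
  resulting error in the decrease condition is small uniformly in the sampled state. On the part of the
  set where \<open>V\<close> is not small, the stage cost dominates this error, and on the rest \<open>V\<close> cannot
  grow beyond \<open>\<beta>\<close> in a short time; hence the terminal set is not left.\<close>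
lemma hold_step:
  assumes "0 < \<epsilon>" "0 < \<beta>"
  obtains h where "0 < h"
    "\<And>a s. V a \<le> \<beta> \<Longrightarrow> 0 \<le> s \<Longrightarrow> s \<le> h \<Longrightarrow>
       \<exists>x u. proc s x u \<and> x 0 = a \<and> V (x s) + run s x u \<le> V a + \<epsilon> * s \<and> V (x s) \<le> \<beta>"
proof -
  define e where "e = min \<epsilon> (ml / MV * (\<beta> / 4))"
  have e: "0 < e" "e \<le> \<epsilon>" "e \<le> ml / MV * (\<beta> / 4)" using assms ml MV by (auto simp: e_def)
  define G where "G = (\<lambda>(x, u). V' x (F x u) + l x u)"
  obtain R where R: "\<And>x. V x \<le> \<beta> \<Longrightarrow> norm x \<le> R"
    using compact_imp_bounded[OF compact_terminal] unfolding bounded_iff by blast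
  let ?K = "cball (0::'a) (R + 1)"
  have cF: "continuous_on S (\<lambda>p. F (fst p) (snd p))" for S
    using continuous_on_subset[OF C1_map_continuous[OF C1_F] subset_UNIV] by (simp add: case_prod_unfold)
  have cl: "continuous_on S (\<lambda>p. l (fst p) (snd p))" for S
    using continuous_on_subset[OF continuous_l subset_UNIV] by (simp add: case_prod_unfold)
  have cV': "continuous_on S (\<lambda>p. V' (fst p))" for S :: "('a \<times> 'b) set"
    by (rule continuous_on_compose2[OF V'_continuous continuous_on_fst[OF continuous_on_id]]) auto
  have cG: "continuous_on S G" for S
    unfolding G_def case_prod_unfold by (intro continuous_on_add blinfun.continuous_on cF cl cV')
  have KU: "compact (?K \<times> U)" by (intro compact_Times compact_U compact_cball)
  have "uniformly_continuous_on (?K \<times> U) G" by (rule compact_uniformly_continuous[OF cG KU])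
  then obtain d1 where d1: "0 < d1"
    "\<And>p q. p \<in> ?K \<times> U \<Longrightarrow> q \<in> ?K \<times> U \<Longrightarrow> dist p q < d1 \<Longrightarrow> dist (G p) (G q) < e"
    using e(1) unfolding uniformly_continuous_on_def by metis
  have "uniformly_continuous_on ?K V"
    by (intro compact_uniformly_continuous continuous_on_subset[OF V_continuous subset_UNIV] compact_cball)
  then obtain d2 where d2: "0 < d2"
    "\<And>p q. p \<in> ?K \<Longrightarrow> q \<in> ?K \<Longrightarrow> dist p q < d2 \<Longrightarrow> dist (V p) (V q) < \<beta> / 4"
    using assms(2) unfolding uniformly_continuous_on_def by (metis divide_pos_pos zero_less_numeral)
  obtain B where B: "0 < B" "\<And>p. p \<in> ?K \<times> U \<Longrightarrow> norm (F (fst p) (snd p)) \<le> B"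
    using compact_image_norm_bound[OF KU cF] by blast
  define d where "d = min 1 (min d1 d2)"
  have d: "0 < d" "d \<le> 1" "d \<le> d1" "d \<le> d2" using d1 d2 by (auto simp: d_def)
  define h where "h = min T (d / (2 * B))"
  have h: "0 < h" "h \<le> T" "h * B < d" using T d B(1) by (auto simp: h_def min_def field_simps)
  have "\<exists>x u. proc s x u \<and> x 0 = a \<and> V (x s) + run s x u \<le> V a + \<epsilon> * s \<and> V (x s) \<le> \<beta>"
    if a: "V a \<le> \<beta>" and s: "0 \<le> s" "s \<le> h" for a s
  proof -
    define u where "u = \<kappa> a"
    have u: "u \<in> U" using \<kappa>_U[OF a] by (simp add: u_def)
    obtain x where pT: "proc T x (\<lambda>_. u)" and x0: "x 0 = a" using const_response[OF u] by blast
    have p: "proc s x (\<lambda>_. u)" using proc_prefix[OF pT s(1)] s(2) h(2) by simp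
    note cx = proc_continuous[OF p]
    have xK: "x t \<in> ?K" if "norm (x t - a) < d" for t
      using that R[OF a] d(2) norm_triangle_sub[of "x t" a] by simp
    have near: "norm (x t - a) < d" if t: "t \<in> {0..s}" for t
    proof (rule ccontr)
      assume far: "\<not> norm (x t - a) < d"
      let ?S = "{0..s} \<inter> (\<lambda>t. norm (x t - a)) -` {d..}"
      have "closed ?S"
        by (rule continuous_closed_preimage) (auto intro!: continuous_on_norm continuous_on_diff cx)
      then have "compact ?S" by (meson bounded_Int bounded_closed_interval compact_eq_bounded_closed)
      moreover have "?S \<noteq> {}" using far t by auto
      ultimately obtain r where r: "r \<in> ?S" "\<And>q. q \<in> ?S \<Longrightarrow> r \<le> q"
        using compact_attains_inf[of ?S] by metis
      then have r0: "0 < r" using x0 d(1) by (cases "r = 0") auto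
      have "\<exists>q\<in>{0<..<r}. norm (x r - x 0) \<le> norm ((\<lambda>h. h *\<^sub>R F (x q) u) (r - 0))"
      proof (rule mvt_general[OF r0])
        show "continuous_on {0..r} x" using cx r by (auto intro: continuous_on_subset)
        fix q assume q: "0 < q" "q < r"
        have "(x has_vector_derivative F (x q) u) (at q within {0..s})"
          by (rule proc_const_input_derivative[OF p]) (use q r in auto)
        moreover have "at q within {0..s} = at q" using q r by (intro at_within_Icc_at) auto
        ultimately show "(x has_derivative (\<lambda>h. h *\<^sub>R F (x q) u)) (at q)"
          by (simp add: has_vector_derivative_def)
      qed
      then obtain q where q: "0 < q" "q < r" "norm (x r - a) \<le> r * norm (F (x q) u)"
        using r0 x0 by auto
      have "q \<notin> ?S" using q r(2)[of q] by auto
      then have "norm (x q - a) < d" using q r(1) by auto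
      then have "norm (F (x q) u) \<le> B" using B(2)[of "(x q, u)"] xK u by simp
      then have "norm (x r - a) \<le> r * B" using q(3) r0 by (meson less_imp_le mult_left_mono order_trans)
      also have "\<dots> \<le> h * B" using r s B(1) by auto
      also have "\<dots> < d" by (rule h(3))
      finally show False using r(1) by simp
    qed
    have Gle: "G (x t, u) \<le> e" if t: "t \<in> {0..s}" for t
    proof -
      have "G (a, u) \<le> 0" using \<kappa>_decrease[OF a] by (simp add: G_def u_def)
      moreover have "dist (G (x t, u)) (G (a, u)) < e"
      proof (rule d1(2))
        show "(x t, u) \<in> ?K \<times> U" using xK[OF near[OF t]] u by simp
        show "(a, u) \<in> ?K \<times> U" using R[OF a] u by simp
        show "dist (x t, u) (a, u) < d1" using near[OF t] d by (simp add: dist_Pair_Pair dist_norm)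
      qed
      ultimately show ?thesis by (simp add: dist_real_def)
    qed
    have Vnear: "\<bar>V (x t) - V a\<bar> < \<beta> / 4" if t: "t \<in> {0..s}" for t
      using d2(2)[of "x t" a] xK[OF near[OF t]] near[OF t] R[OF a] d by (simp add: dist_real_def dist_norm)
    have "((\<lambda>t. V' (x t) (F (x t) u)) has_integral (V (x s) - V (x 0))) {0..s}"
    proof (rule fundamental_theorem_of_calculus[OF s(1), of "\<lambda>t. V (x t)"])
      fix t assume t: "t \<in> {0..s}"
      have "((V \<circ> x) has_derivative (V' (x t) \<circ> (\<lambda>h. h *\<^sub>R F (x t) u))) (at t within {0..s})"
        by (rule diff_chain_within[OF proc_const_input_derivative[OF p t, unfolded has_vector_derivative_def]
              has_derivative_at_withinI[OF V_derivative]])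
      then show "((\<lambda>t. V (x t)) has_vector_derivative V' (x t) (F (x t) u)) (at t within {0..s})"
        by (simp add: has_vector_derivative_def o_def blinfun.scaleR_right)
    qed
    from has_integral_add[OF this integrable_integral[OF proc_integrable[OF p continuous_l]]]
    have "((\<lambda>t. G (x t, u)) has_integral (V (x s) - V a + run s x (\<lambda>_. u))) {0..s}"
      by (simp add: G_def run_def x0)
    moreover have "((\<lambda>_. e) has_integral (s * e)) {0..s}"
      using has_integral_const_real[of e 0 s] s by simp
    ultimately have main: "V (x s) - V a + run s x (\<lambda>_. u) \<le> s * e"
      by (rule has_integral_le) (rule Gle)
    have run_ge: "s * (ml / MV * (V a - \<beta> / 4)) \<le> run s x (\<lambda>_. u)"
    proof (rule run_ge_const[OF p])
      fix t assume t: "t \<in> {0..s}"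
      have "V a - \<beta> / 4 \<le> MV * (norm (x t))\<^sup>2" using Vnear[OF t] V_le[of "x t"] by linarith
      then have "ml / MV * (V a - \<beta> / 4) \<le> ml * (norm (x t))\<^sup>2"
        using ml MV mult_left_mono[of "V a - \<beta> / 4" "MV * (norm (x t))\<^sup>2" "ml / MV"] by simp
      then show "ml / MV * (V a - \<beta> / 4) \<le> l (x t) u" using l_ge_state[of "x t" u] by linarith
    qed
    have "V (x s) \<le> \<beta>"
    proof (cases "\<beta> / 2 \<le> V a")
      case True
      have "s * e \<le> s * (ml / MV * (V a - \<beta> / 4))"
        using True e(3) ml MV s by (intro mult_left_mono order_trans[OF e(3)]) auto
      then show ?thesis using main run_ge a by linarith
    next
      case False
      moreover have "\<bar>V (x s) - V a\<bar> < \<beta> / 4" using Vnear[of s] s(1) by simp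
      ultimately show ?thesis using assms(2) by linarith
    qed
    moreover have "s * e \<le> \<epsilon> * s" using e(2) s by (simp add: mult.commute mult_right_mono)
    ultimately show ?thesis using p x0 main by (intro exI[of _ x] exI[of _ "\<lambda>_. u"]) auto
  qed
  with h(1) show ?thesis using that by blast
qed

lemma terminal_process:
  assumes a: "V a \<le> \<beta>" and S: "0 \<le> S" and \<epsilon>: "0 < \<epsilon>"
  shows "\<exists>x u. proc S x u \<and> x 0 = a \<and> V (x S) + run S x u \<le> V a + \<epsilon> * S"
proof (cases "\<beta> = 0")
  case True
  then have "a = 0" using a V_nonneg[of a] V_zero[of a] by simp
  then show ?thesis
    using proc_zero[OF S] run_zero V_0 \<epsilon> S by (intro exI[of _ "\<lambda>_. 0"]) simp
next
  case False
  then obtain h where h: "0 < h"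
    "\<And>a s. V a \<le> \<beta> \<Longrightarrow> 0 \<le> s \<Longrightarrow> s \<le> h \<Longrightarrow>
       \<exists>x u. proc s x u \<and> x 0 = a \<and> V (x s) + run s x u \<le> V a + \<epsilon> * s \<and> V (x s) \<le> \<beta>"
    using hold_step[OF \<epsilon>] \<beta> by (metis order_le_less)
  obtain n :: nat where n: "S / h < real n" using reals_Archimedean2 by blast
  define s where "s = S / real n"
  have n0: "0 < real n" using n S h(1) by (smt (verit) divide_nonneg_pos)
  have s: "0 \<le> s" "s \<le> h" "real n * s = S" using n n0 S h(1) by (auto simp: s_def field_simps)
  have "\<exists>x u. proc (real k * s) x u \<and> x 0 = a \<and> V (x (real k * s)) + run (real k * s) x u \<le> V a + \<epsilon> * (real k * s) \<and>
      V (x (real k * s)) \<le> \<beta>" for k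
  proof (induction k)
    case 0
    show ?case using h(2)[OF a, of 0] h(1) by simp
  next
    case (Suc k)
    then obtain x u where x: "proc (real k * s) x u" "x 0 = a"
      "V (x (real k * s)) + run (real k * s) x u \<le> V a + \<epsilon> * (real k * s)" "V (x (real k * s)) \<le> \<beta>"
      by blast
    obtain y v where y: "proc s y v" "y 0 = x (real k * s)"
      "V (y s) + run s y v \<le> V (x (real k * s)) + \<epsilon> * s" "V (y s) \<le> \<beta>"
      using h(2)[OF x(4) s(1,2)] by blast
    obtain z w where "proc (real k * s + s) z w" "z 0 = x 0" "z (real k * s + s) = y s"
      "run (real k * s + s) z w = run (real k * s) x u + run s y v"
      using proc_append[OF x(1) y(1,2)] by blast
    moreover have "real (Suc k) * s = real k * s + s" by (simp add: algebra_simps)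
    ultimately show ?case
      using x y by (intro exI[of _ z] exI[of _ w]) (simp add: algebra_simps)
  qed
  from this[of n] show ?thesis using s(3) by metis
qed

text \<open>An initial piece of the optimal process followed by any continuation is a competitor of it.\<close>
lemma optimal_tail:
  assumes r: "0 \<le> r" "r \<le> T" and p: "proc (T - r) y v" "y 0 = xo a r"
  shows "J a \<le> run r (xo a) (uo a) + V (y (T - r)) + run (T - r) y v"
proof -
  have "proc r (xo a) (uo a)" by (rule proc_prefix[OF opt_proc r])
  then obtain z w where z: "proc (r + (T - r)) z w" "z 0 = xo a 0" "z (r + (T - r)) = y (T - r)"
    "run (r + (T - r)) z w = run r (xo a) (uo a) + run (T - r) y v"
    using proc_append[of r "xo a" "uo a" "T - r" y v] p by blast
  have "J (z 0) \<le> V (z T) + run T z w"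
    unfolding run_def by (rule J_le) (use z(1) in simp)
  then show ?thesis using z opt_start by simp
qed

lemma J_split:
  assumes r: "0 \<le> r" "r \<le> T"
  shows "J a = run r (xo a) (uo a) + V (xo a T) + run (T - r) (\<lambda>t. xo a (t + r)) (\<lambda>t. uo a (t + r))"
  using opt_cost[of a] proc_tail(2)[OF opt_proc r, of a] by (simp add: run_def)

text \<open>Once the optimal trajectory has met the terminal set it ends there, because the terminal law
  offers a tail whose final cost is at most \<open>\<beta>\<close>. A trajectory avoiding the terminal set would pay
  a stage cost of at least \<open>\<beta> * ml / MV\<close> all along the horizon.\<close>
lemma optimal_ends_in_terminal:
  assumes J: "J a \<le> \<beta> * (1 + ml / MV * T)"
  shows "V (xo a T) \<le> \<beta>"
proof (rule ccontr)
  assume out: "\<not> V (xo a T) \<le> \<beta>"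
  have avoid: "\<beta> < V (xo a r)" if r: "r \<in> {0..T}" for r
  proof (rule ccontr)
    assume "\<not> \<beta> < V (xo a r)"
    then have Vr: "V (xo a r) \<le> \<beta>" by simp
    have r: "0 \<le> r" "r \<le> T" using r by auto
    have "V (xo a T) \<le> V (xo a r) + \<epsilon>" if "0 < \<epsilon>" for \<epsilon>
    proof -
      have "0 < \<epsilon> / T" using T that by simp
      then obtain y v where y: "proc (T - r) y v" "y 0 = xo a r"
        "V (y (T - r)) + run (T - r) y v \<le> V (xo a r) + \<epsilon> / T * (T - r)"
        using terminal_process[OF Vr] r by (metis diff_ge_0_iff_ge)
      have "\<epsilon> / T * (T - r) \<le> \<epsilon> / T * T" using r T that by (intro mult_left_mono) auto
      then have "\<epsilon> / T * (T - r) \<le> \<epsilon>" using T by simp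
      then show ?thesis
        using y(3) optimal_tail[OF r y(1,2)] J_split[OF r, of a] run_nonneg[OF proc_tail(1)[OF opt_proc r], of a]
        by linarith
    qed
    then have "V (xo a T) \<le> V (xo a r)" by (rule field_le_epsilon)
    then show False using Vr out by simp
  qed
  have "T * (ml / MV * \<beta>) \<le> run T (xo a) (uo a)"
  proof (rule run_ge_const[OF opt_proc])
    fix t assume "t \<in> {0..T}"
    then have "\<beta> \<le> MV * (norm (xo a t))\<^sup>2" using avoid[of t] V_le[of "xo a t"] by simp
    then have "ml / MV * \<beta> \<le> ml * (norm (xo a t))\<^sup>2"
      using ml MV mult_left_mono[of \<beta> "MV * (norm (xo a t))\<^sup>2" "ml / MV"] by simp
    then show "ml / MV * \<beta> \<le> l (xo a t) (uo a t)" using l_ge_state[of "xo a t" "uo a t"] by linarith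
  qed
  then show False
    using J opt_cost[of a] out by (simp add: run_def algebra_simps)
qed

text \<open>The rest of the optimal process, extended by a process in the terminal set that repays its running
  cost, is a competitor for the problem started at \<open>xo a s\<close>.\<close>
lemma optimal_cost_decrease:
  assumes J: "J a \<le> \<beta> * (1 + ml / MV * T)" and s: "0 \<le> s" "s \<le> T"
  shows "J (xo a s) \<le> J a - run s (xo a) (uo a)"
proof (rule field_le_epsilon)
  fix \<epsilon> :: real assume \<epsilon>: "0 < \<epsilon>"
  note tail = proc_tail(1)[OF opt_proc s, of a]
  obtain y v where y: "proc s y v" "y 0 = xo a T" "V (y s) + run s y v \<le> V (xo a T) + \<epsilon> / T * s"
    using terminal_process[OF optimal_ends_in_terminal[OF J] s(1), of "\<epsilon> / T"] \<epsilon> T by auto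
  obtain z w where z: "proc (T - s + s) z w" "z 0 = xo a (0 + s)" "z (T - s + s) = y s"
    "run (T - s + s) z w = run (T - s) (\<lambda>t. xo a (t + s)) (\<lambda>t. uo a (t + s)) + run s y v"
    using proc_append[OF tail y(1)] y(2) by auto
  have "J (z 0) \<le> V (z T) + run T z w"
    unfolding run_def by (rule J_le) (use z(1) in simp)
  moreover have "\<epsilon> / T * s \<le> \<epsilon>"
    using s T \<epsilon> mult_left_mono[OF s(2), of "\<epsilon> / T"] by simp
  ultimately show "J (xo a s) \<le> J a - run s (xo a) (uo a) + \<epsilon>"
    using z y(3) J_split[OF s, of a] by simp
qed

text \<open>A process whose speed is bounded by a multiple of its norm needs time to come close to the origin.\<close>
lemma run_lower_bound:
  assumes L: "0 < L" and s: "0 < s"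
  obtains m where "0 < m"
    "\<And>x u. proc s x u \<Longrightarrow> (\<And>t. t \<in> {0..s} \<Longrightarrow> norm (F (x t) (u t)) \<le> L * norm (x t)) \<Longrightarrow>
       m * (norm (x 0))\<^sup>2 \<le> run s x u"
proof -
  define E where "E = 2 * L * exp (L * s)"
  have E: "0 < E" using L by (simp add: E_def)
  define r where "r = min s (1 / E)"
  have r: "0 < r" "r \<le> s" "r \<le> 1 / E" using E s by (simp_all add: r_def)
  have rL: "L * r * exp (L * s) \<le> 1 / 2" 
    using r(3) E unfolding pos_le_divide_eq[OF E] by (simp add: E_def mult.commute mult.left_commute)
  have "r * (ml / 4) * (norm (x 0))\<^sup>2 \<le> run s x u"
    if p: "proc s x u" and F: "\<And>t. t \<in> {0..s} \<Longrightarrow> norm (F (x t) (u t)) \<le> L * norm (x t)" for x u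
  proof -
    have pr: "proc r x u" by (rule proc_prefix[OF p]) (use r in auto)
    have "r * (ml * (norm (x 0) / 2)\<^sup>2) \<le> run r x u"
    proof (rule run_ge_const[OF pr])
      fix t assume t: "t \<in> {0..r}"
      have "norm (x t - x 0) \<le> L * t * norm (x 0) * exp (L * s)"
        by (rule growth(1)[OF p _ F]) (use t L r in auto)
      also have "\<dots> \<le> L * r * norm (x 0) * exp (L * s)"
        using t L by (intro mult_right_mono mult_left_mono) auto
      also have "\<dots> = (L * r * exp (L * s)) * norm (x 0)" by simp
      also have "\<dots> \<le> 1 / 2 * norm (x 0)" by (rule mult_right_mono[OF rL norm_ge_zero])
      finally have "norm (x 0) / 2 \<le> norm (x t)"
        using norm_triangle_sub[of "x 0" "x t"] by (simp add: norm_minus_commute)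
      then have "(norm (x 0) / 2)\<^sup>2 \<le> (norm (x t))\<^sup>2" by (rule power_mono) simp
      then show "ml * (norm (x 0) / 2)\<^sup>2 \<le> l (x t) (u t)"
        using l_ge_state[of "x t" "u t"] ml by (meson less_imp_le mult_left_mono order_trans)
    qed
    also have "run r x u \<le> run s x u"
      using proc_tail(2)[OF p, of r] run_nonneg[OF proc_tail(1)[OF p, of r]] r by simp
    finally show ?thesis by (simp add: power_divide)
  qed
  then show ?thesis using that[of "r * (ml / 4)"] r(1) ml by simp
qed

lemma J_nonneg: "0 \<le> J a"
  using opt_cost[of a] V_nonneg[of "xo a T"] run_nonneg[OF opt_proc, of a] by (simp add: run_def)

lemma J_0: "J 0 = 0"
proof -
  have "J ((\<lambda>_. 0) 0) \<le> V 0 + run T (\<lambda>_. 0) (\<lambda>_. 0)"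
    unfolding run_def by (rule J_le[OF proc_zero]) (use T in simp)
  then show ?thesis using J_nonneg[of 0] V_0 run_zero by simp
qed

end

section \<open>Robustness of the decrease\<close>

text \<open>The derivative vanishes at the minimum \<open>0\<close> and is Lipschitz continuous, so increments are bounded by
  the distance of the points times their norm.\<close>
lemma C2_map_increment_at_minimum:
  fixes g :: "'a::euclidean_space \<Rightarrow> real"
  assumes g: "C2_map g" and min: "\<And>x. g 0 \<le> g x"
  obtains c where "0 < c"
    "\<And>x y r. norm x \<le> r \<Longrightarrow> norm y \<le> r \<Longrightarrow> r \<le> R \<Longrightarrow> \<bar>g y - g x\<bar> \<le> c * r * norm (y - x)"
proof -
  obtain g' :: "'a \<Rightarrow> 'a \<Rightarrow>\<^sub>L real"
    where g': "\<And>x. (g has_derivative blinfun_apply (g' x)) (at x)" "C1_map g'"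
    using g unfolding C2_map_def by blast
  obtain c where c: "0 < c"
    "\<And>x y. norm x \<le> R \<Longrightarrow> norm y \<le> R \<Longrightarrow> norm (g' x - g' y) \<le> c * norm (x - y)"
    using C1_map_Lipschitz_cball[OF g'(2)] by blast
  have "g' 0 = 0"
    using differential_zero_maxmin[of 0 UNIV g "blinfun_apply (g' 0)"] g'(1) min
    by (auto intro!: blinfun_eqI simp: fun_eq_iff)
  have "\<bar>g y - g x\<bar> \<le> c * r * norm (y - x)" if r: "norm x \<le> r" "norm y \<le> r" "r \<le> R" for x y r
  proof -
    have "norm (g y - g x) \<le> c * r * norm (y - x)"
    proof (rule differentiable_bound[of "cball 0 r" g "\<lambda>x. blinfun_apply (g' x)"])
      fix z :: 'a assume z: "z \<in> cball 0 r"
      show "(g has_derivative blinfun_apply (g' z)) (at z within cball 0 r)"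
        by (rule has_derivative_at_withinI[OF g'(1)])
      have "0 \<le> R" using r norm_ge_zero[of x] by linarith
      then have "norm (g' z) \<le> c * norm z" using c(2)[of z 0] z r(3) \<open>g' 0 = 0\<close> by simp
      also have "\<dots> \<le> c * r" using z c(1) by (intro mult_left_mono) auto
      finally show "onorm (blinfun_apply (g' z)) \<le> c * r" by (simp add: norm_blinfun.rep_eq)
    qed (use r in auto)
    then show ?thesis by simp
  qed
  with c(1) show ?thesis using that by blast
qed

text \<open>The linear bounds hold when the optimal input is generated by a Lipschitz feedback that vanishes at the
  origin. Their range \<open>J a \<le> \<beta> * (1 + ml / MV * T)\<close> is that of \<open>optimal_cost_decrease\<close>.\<close>
locale mpc_feedback = mpc_problem F U l V V' T \<beta> ml Ml MV \<kappa> J xo uo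
  for F :: "'a::euclidean_space \<Rightarrow> 'b::euclidean_space \<Rightarrow> 'a"
    and U l V V' T \<beta> ml Ml MV \<kappa> J xo uo +
  fixes L K \<delta> :: real
  assumes L: "0 < L" and \<delta>: "0 < \<delta>" "\<delta> \<le> T"
    and F_feedback: "\<And>a t. J a \<le> \<beta> * (1 + ml / MV * T) \<Longrightarrow> t \<in> {0..T} \<Longrightarrow>
      norm (F (xo a t) (uo a t)) \<le> L * norm (xo a t)"
    and u_feedback: "\<And>a t. J a \<le> \<beta> * (1 + ml / MV * T) \<Longrightarrow> t \<in> {0..T} \<Longrightarrow>
      norm (uo a t) \<le> K * norm (xo a t)"
    and J_C2: "C2_map J"
begin

definition \<alpha> :: real where "\<alpha> = \<beta> * (1 + ml / MV * T)"

lemma \<alpha>_nonneg: "0 \<le> \<alpha>" using \<beta> ml MV T by (simp add: \<alpha>_def)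

lemma optimal_growth:
  assumes "J a \<le> \<alpha>" "t \<in> {0..T}"
  shows "norm (xo a t) \<le> exp (L * T) * norm a"
proof -
  have "norm (xo a t) \<le> norm (xo a 0) * exp (L * t)"
    by (rule growth(2)[OF opt_proc]) (use assms L F_feedback in \<open>auto simp: \<alpha>_def\<close>)
  also have "\<dots> \<le> norm (xo a 0) * exp (L * T)"
    using assms L by (intro mult_left_mono) auto
  finally show ?thesis by (simp add: opt_start mult.commute)
qed

lemma J_upper:
  obtains M where "0 < M" "\<And>a. J a \<le> \<alpha> \<Longrightarrow> J a \<le> M * (norm a)\<^sup>2"
proof -
  define E where "E = (exp (L * T))\<^sup>2"
  define M where "M = MV * E + T * (\<bar>Ml\<bar> * ((1 + K\<^sup>2) * E))"
  have "J a \<le> M * (norm a)\<^sup>2" if a: "J a \<le> \<alpha>" for a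
  proof -
    have x: "(norm (xo a t))\<^sup>2 \<le> E * (norm a)\<^sup>2" if "t \<in> {0..T}" for t
      using power_mono[OF optimal_growth[OF a that], of 2] by (simp add: E_def power_mult_distrib)
    have l: "l (xo a t) (uo a t) \<le> \<bar>Ml\<bar> * ((1 + K\<^sup>2) * (E * (norm a)\<^sup>2))" if t: "t \<in> {0..T}" for t
    proof -
      have "(norm (uo a t))\<^sup>2 \<le> (K * norm (xo a t))\<^sup>2"
        by (rule power_mono[OF u_feedback]) (use a t in \<open>auto simp: \<alpha>_def\<close>)
      then have "(norm (xo a t))\<^sup>2 + (norm (uo a t))\<^sup>2 \<le> (1 + K\<^sup>2) * (norm (xo a t))\<^sup>2"
        by (simp add: algebra_simps power_mult_distrib)
      also have "\<dots> \<le> (1 + K\<^sup>2) * (E * (norm a)\<^sup>2)"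
        by (rule mult_left_mono[OF x[OF t]]) simp
      finally have "\<bar>Ml\<bar> * ((norm (xo a t))\<^sup>2 + (norm (uo a t))\<^sup>2) \<le> \<bar>Ml\<bar> * ((1 + K\<^sup>2) * (E * (norm a)\<^sup>2))"
        by (rule mult_left_mono) simp
      moreover have "Ml * ((norm (xo a t))\<^sup>2 + (norm (uo a t))\<^sup>2) \<le> \<bar>Ml\<bar> * ((norm (xo a t))\<^sup>2 + (norm (uo a t))\<^sup>2)"
        by (rule mult_right_mono) auto
      ultimately show ?thesis using l_le[of "xo a t" "uo a t"] by linarith
    qed
    have "run T (xo a) (uo a) \<le> integral {0..T} (\<lambda>_. \<bar>Ml\<bar> * ((1 + K\<^sup>2) * (E * (norm a)\<^sup>2)))"
      unfolding run_def by (rule integral_le[OF proc_integrable[OF opt_proc continuous_l] integrable_const_ivl]) (rule l)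
    then have "run T (xo a) (uo a) \<le> T * (\<bar>Ml\<bar> * ((1 + K\<^sup>2) * (E * (norm a)\<^sup>2)))" using T by (simp add: mult_ac)
    moreover have "V (xo a T) \<le> MV * (E * (norm a)\<^sup>2)"
      using MV T by (intro order_trans[OF V_le] mult_left_mono x) auto
    ultimately show ?thesis using opt_cost[of a] by (simp add: run_def M_def algebra_simps)
  qed
  moreover have "0 < M"
    using MV T by (simp add: M_def E_def add_pos_nonneg)
  ultimately show ?thesis using that by blast
qed

lemma J_lower:
  obtains m where "0 < m" "\<And>a. J a \<le> \<alpha> \<Longrightarrow> m * (norm a)\<^sup>2 \<le> run \<delta> (xo a) (uo a)"
    "\<And>a. J a \<le> \<alpha> \<Longrightarrow> m * (norm a)\<^sup>2 \<le> J a"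
proof -
  obtain m where m: "0 < m" "\<And>x u. proc \<delta> x u \<Longrightarrow>
      (\<And>t. t \<in> {0..\<delta>} \<Longrightarrow> norm (F (x t) (u t)) \<le> L * norm (x t)) \<Longrightarrow> m * (norm (x 0))\<^sup>2 \<le> run \<delta> x u"
    using run_lower_bound[OF L \<delta>(1)] by blast
  have *: "m * (norm a)\<^sup>2 \<le> run \<delta> (xo a) (uo a)" if "J a \<le> \<alpha>" for a
    using m(2)[OF proc_prefix[OF opt_proc], of a] F_feedback[of a] that \<delta> opt_start by (simp add: \<alpha>_def)
  moreover have "m * (norm a)\<^sup>2 \<le> J a" if a: "J a \<le> \<alpha>" for a
  proof -
    have \<delta>': "0 \<le> \<delta>" using \<delta> by simp
    show ?thesis
      using *[OF a] J_split[OF \<delta>' \<delta>(2), of a] V_nonneg[of "xo a T"]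
        run_nonneg[OF proc_tail(1)[OF opt_proc \<delta>' \<delta>(2)], of a]
      by linarith
  qed
  ultimately show ?thesis using that m(1) by blast
qed

text \<open>The cost decreases by a fixed fraction along the optimal trajectory, by an amount quadratic in
  \<open>norm a\<close>. A deviation from it that is proportional to \<open>norm a\<close> changes the cost by an amount
  that is also quadratic in \<open>norm a\<close> but carries the small factor \<open>d\<close>.\<close>
lemma inexact_decrease:
  assumes D: "0 \<le> D"
  obtains d0 \<theta> where "0 < d0" "0 < \<theta>" "\<theta> < 1"
    "\<And>d a y. 0 < d \<Longrightarrow> d \<le> d0 \<Longrightarrow> J a \<le> \<alpha> \<Longrightarrow> norm (y - xo a \<delta>) \<le> D * d * norm a \<Longrightarrow> J y \<le> \<theta> * J a"
proof -
  obtain m where m: "0 < m" "\<And>a. J a \<le> \<alpha> \<Longrightarrow> m * (norm a)\<^sup>2 \<le> run \<delta> (xo a) (uo a)"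
    "\<And>a. J a \<le> \<alpha> \<Longrightarrow> m * (norm a)\<^sup>2 \<le> J a"
    using J_lower by blast
  obtain M0 where M0: "0 < M0" "\<And>a. J a \<le> \<alpha> \<Longrightarrow> J a \<le> M0 * (norm a)\<^sup>2" using J_upper by blast
  define M where "M = max M0 m"
  have M: "0 < M" "m \<le> M" "J a \<le> M * (norm a)\<^sup>2" if "J a \<le> \<alpha>" for a
    using M0(1) M0(2)[OF that] mult_right_mono[of M0 M "(norm a)\<^sup>2"] by (auto simp: M_def)
  have M0': "0 < M" "m \<le> M" using M0(1) by (auto simp: M_def)
  define E where "E = exp (L * T) + D"
  have E: "0 < E" using D by (simp add: E_def add_pos_nonneg)
  obtain c where c: "0 < c" "\<And>x y r. norm x \<le> r \<Longrightarrow> norm y \<le> r \<Longrightarrow> r \<le> E * sqrt (\<alpha> / m) \<Longrightarrow>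
      \<bar>J y - J x\<bar> \<le> c * r * norm (y - x)"
    using C2_map_increment_at_minimum[OF J_C2] J_0 J_nonneg by metis
  define q where "q = m / (2 * M)"
  have q: "0 < q" "q \<le> 1 / 2" using m(1) M0' by (auto simp: q_def field_simps)
  define B where "B = c * E * D / m"
  have B: "0 \<le> B" using c E D m by (simp add: B_def)
  define d0 where "d0 = min 1 (q / (B + 1))"
  have d0: "0 < d0" "d0 \<le> 1" "d0 \<le> q / (B + 1)" using q B by (auto simp: d0_def)
  have "J y \<le> (1 - q) * J a"
    if d: "0 < d" "d \<le> d0" and a: "J a \<le> \<alpha>" and y: "norm (y - xo a \<delta>) \<le> D * d * norm a" for d a y
  proof -
    have run: "2 * q * J a \<le> run \<delta> (xo a) (uo a)"
    proof -
      have "2 * q * J a \<le> 2 * q * (M * (norm a)\<^sup>2)"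
        using M(3)[OF a] q by (intro mult_left_mono) auto
      also have "\<dots> = m * (norm a)\<^sup>2" using M0' by (simp add: q_def)
      finally show ?thesis using m(2)[OF a] by linarith
    qed
    have "J (xo a \<delta>) \<le> J a - run \<delta> (xo a) (uo a)"
      by (rule optimal_cost_decrease) (use a \<delta> in \<open>auto simp: \<alpha>_def\<close>)
    then have opt: "J (xo a \<delta>) \<le> J a - 2 * q * J a" using run by linarith
    have "D * d * norm a \<le> D * norm a"
      using D d d0 by (intro mult_right_mono) (auto simp: mult_left_le)
    then have ny: "norm y \<le> E * norm a"
      using y norm_triangle_sub[of y "xo a \<delta>"] optimal_growth[OF a, of \<delta>] \<delta>
      by (simp add: E_def algebra_simps)
    have nx: "norm (xo a \<delta>) \<le> E * norm a"
      using optimal_growth[OF a, of \<delta>] \<delta> D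
      by (intro order_trans[OF optimal_growth[OF a, of \<delta>]]) (auto simp: E_def intro!: mult_right_mono)
    have "(norm a)\<^sup>2 \<le> \<alpha> / m" using m(1) m(3)[OF a] a by (simp add: field_simps)
    then have "norm a \<le> sqrt (\<alpha> / m)" by (rule real_le_rsqrt)
    then have "\<bar>J y - J (xo a \<delta>)\<bar> \<le> c * (E * norm a) * norm (y - xo a \<delta>)"
      using c(2)[OF nx ny] E by simp
    also have "\<dots> \<le> c * (E * norm a) * (D * d * norm a)"
      using y c(1) E by (intro mult_left_mono) auto
    also have "\<dots> = B * d * (m * (norm a)\<^sup>2)" using m(1) by (simp add: B_def power2_eq_square)
    also have "\<dots> \<le> B * d * J a" using m(3)[OF a] B d by (intro mult_left_mono) auto
    also have "\<dots> \<le> q * J a"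
    proof (rule mult_right_mono[OF _ J_nonneg])
      have "B * d \<le> (B + 1) * (q / (B + 1))" using B d d0 by (intro mult_mono) auto
      then show "B * d \<le> q" using B by simp
    qed
    finally show ?thesis using opt by (simp add: algebra_simps)
  qed
  then show ?thesis using that[of d0 "1 - q"] d0(1) q by simp
qed

end

section \<open>The networked plant as a control system\<close>

lemma bounded_linear_sblk: "bounded_linear (sblk P i)"
  unfolding linear_conv_bounded_linear[symmetric]
  by (rule linearI) (auto simp: sblk_def vec_eq_iff)

lemma bounded_linear_iblk: "bounded_linear (iblk P i)"
  unfolding linear_conv_bounded_linear[symmetric]
  by (rule linearI) (auto simp: iblk_def vec_eq_iff)

lemma bounded_linear_nblk: "bounded_linear (nblk P i)"
  unfolding linear_conv_bounded_linear[symmetric]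
  by (rule linearI) (auto simp: nblk_def vec_eq_iff)

lemma bounded_linear_copy: "bounded_linear (copy P)"
  unfolding linear_conv_bounded_linear[symmetric]
  by (rule linearI) (auto simp: copy_def nblk_def vec_eq_iff)

lemma sum_sblk: "(\<Sum>i\<in>UNIV. sblk P i x) = x"
  by (simp add: vec_eq_iff sblk_def)

lemma sum_iblk: "(\<Sum>i\<in>UNIV. iblk P i u) = u"
  by (simp add: vec_eq_iff iblk_def)

lemma C1_map_Fdyn:
  fixes P :: "('v::finite, 'n::finite, 'm::finite) dmpc"
  assumes "\<And>i. C1_map (\<lambda>(x, u, v). dyn P i x u v)"
  shows "C1_map (\<lambda>(x, u). Fdyn P x u)"
proof -
  have "C1_map (\<lambda>p. \<Sum>i\<in>UNIV. sblk P i ((\<lambda>(x, u, v). dyn P i x u v)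
      (sblk P i (fst p), iblk P i (snd p), nblk P i (nblk P i (fst p)))))"
    by (intro C1_map_sum finite C1_map_linear_compose[OF _ bounded_linear_sblk]
        C1_map_compose_linear[OF assms] bounded_linear_Pair
        bounded_linear_compose[OF bounded_linear_sblk bounded_linear_fst]
        bounded_linear_compose[OF bounded_linear_iblk bounded_linear_snd]
        bounded_linear_compose[OF bounded_linear_nblk bounded_linear_compose[OF bounded_linear_nblk bounded_linear_fst]])
  then show ?thesis
    by (simp add: Fdyn_def fdec_def copy_def case_prod_unfold)
qed

lemma C1_map_Vcost:
  fixes P :: "('v::finite, 'n::finite, 'm::finite) dmpc"
  assumes "\<And>i. C1_map (tcost P i)"
  shows "C1_map (Vcost P)"
  unfolding Vcost_def[abs_def]
  by (intro C1_map_sum finite C1_map_compose_linear[OF assms bounded_linear_sblk])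

lemma continuous_lcost:
  fixes P :: "('v::finite, 'n::finite, 'm::finite) dmpc"
  assumes "\<And>i. C1_map (\<lambda>(x, u). scost P i x u)"
  shows "continuous_on UNIV (\<lambda>(x, u). lcost P x u)"
proof -
  have "C1_map (\<lambda>p. \<Sum>i\<in>UNIV. (\<lambda>(x, u). scost P i x u) (sblk P i (fst p), iblk P i (snd p)))"
    by (intro C1_map_sum finite C1_map_compose_linear[OF assms] bounded_linear_Pair
        bounded_linear_compose[OF bounded_linear_sblk bounded_linear_fst]
        bounded_linear_compose[OF bounded_linear_iblk bounded_linear_snd])
  then show ?thesis
    by (intro C1_map_continuous) (simp add: lcost_def case_prod_unfold)
qed

lemma compact_Uset:
  assumes "\<And>i. compact (inset P i)"
  shows "compact (Uset P)"
proof -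
  have "closed (iblk P i -` inset P i)" for i
    by (intro continuous_closed_vimage compact_imp_closed assms
        linear_continuous_at bounded_linear_iblk)
  moreover have "Uset P = (\<Inter>i. iblk P i -` inset P i)" by (auto simp: Uset_def)
  ultimately have "closed (Uset P)" by auto
  moreover have "bounded (Uset P)"
  proof -
    have "\<exists>B. \<forall>u\<in>inset P i. norm u \<le> B" for i
      using compact_imp_bounded[OF assms[of i]] unfolding bounded_iff .
    then obtain B where B: "\<And>i u. u \<in> inset P i \<Longrightarrow> norm u \<le> B i" by metis
    have "norm u \<le> sum B UNIV" if "u \<in> Uset P" for u
    proof -
      have "norm (\<Sum>i\<in>UNIV. iblk P i u) \<le> sum B UNIV"
        by (rule sum_norm_le) (use that B in \<open>auto simp: Uset_def\<close>)
      then show ?thesis by (simp add: sum_iblk)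
    qed
    then show ?thesis unfolding bounded_iff by blast
  qed
  ultimately show ?thesis by (simp add: compact_eq_bounded_closed)
qed

lemma controls_iff:
  assumes "compact (Uset P)"
  shows "u \<in> controls P \<longleftrightarrow> u integrable_on {0..hor P} \<and> u ` {0..hor P} \<subseteq> Uset P"
proof
  assume u: "u \<in> controls P"
  then have "bounded (u ` {0..hor P})" by (simp add: controls_def Linf_def)
  then obtain B where B: "\<And>t. t \<in> {0..hor P} \<Longrightarrow> norm (u t) \<le> B" unfolding bounded_iff by blast
  have "u integrable_on {0..hor P}"
    by (rule measurable_bounded_by_integrable_imp_integrable[where g = "\<lambda>_. B"])
       (use u B in \<open>auto simp: controls_def Linf_def\<close>)
  then show "u integrable_on {0..hor P} \<and> u ` {0..hor P} \<subseteq> Uset P"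
    using u by (simp add: controls_def Linf_def)
next
  assume u: "u integrable_on {0..hor P} \<and> u ` {0..hor P} \<subseteq> Uset P"
  then have "bounded (u ` {0..hor P})"
    using compact_imp_bounded[OF assms] bounded_subset by blast
  then show "u \<in> controls P"
    using u by (simp add: controls_def Linf_def integrable_imp_measurable)
qed

lemma process_iff:
  assumes "compact (Uset P)" "0 < hor P"
  shows "process (Fdyn P) (Uset P) (hor P) x u \<longleftrightarrow> u \<in> controls P \<and> is_resp P u (x 0) x"
  using controls_iff[OF assms(1), of u] assms(2) by (auto simp: process_def is_resp_def)

lemma standing_control_system:
  assumes "standing P ml Ml mV MV"
  shows "control_system (Fdyn P) (Uset P) (lcost P)"
  using assms unfolding standing_def
  by (auto intro!: control_system.intro C1_map_Fdyn continuous_lcost compact_Uset)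

text \<open>Uniqueness of responses makes the choice in their definition harmless, so every process of the
  plant yields an upper bound of the optimal cost.\<close>
lemma standing_optimal_control:
  fixes P :: "('v::finite, 'n::finite, 'm::finite) dmpc"
  assumes st: "standing P ml Ml mV MV"
  shows "\<And>u a. u \<in> controls P \<Longrightarrow> process (Fdyn P) (Uset P) (hor P) (resp P u a) u \<and> resp P u a 0 = a"
    and "\<And>x u. process (Fdyn P) (Uset P) (hor P) x u \<Longrightarrow>
      Jopt P (x 0) \<le> Vcost P (x (hor P)) + integral {0..hor P} (\<lambda>t. lcost P (x t) (u t))"
    and "\<And>a. process (Fdyn P) (Uset P) (hor P) (optx P a) (optu P a)"
    and "\<And>a. optx P a 0 = a"
    and "\<And>a. Jopt P a = Vcost P (optx P a (hor P)) + integral {0..hor P} (\<lambda>t. lcost P (optx P a t) (optu P a t))"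
proof -
  interpret control_system "Fdyn P" "Uset P" "lcost P" by (rule standing_control_system[OF st])
  note st = st[unfolded standing_def]
  have hor: "0 < hor P" using st by simp
  note piff = process_iff[OF compact_U hor]
  show resp: "process (Fdyn P) (Uset P) (hor P) (resp P u a) u \<and> resp P u a 0 = a"
    if u: "u \<in> controls P" for u a
  proof -
    have "\<exists>x. is_resp P u a x" using st u by blast
    then have r: "is_resp P u a (resp P u a)" unfolding resp_def by (rule someI_ex)
    moreover from r have "resp P u a 0 = a" by (simp add: is_resp_def solves_def)
    ultimately show ?thesis using u piff by simp
  qed
  have opt: "optu P a \<in> controls P" "\<And>u. u \<in> controls P \<Longrightarrow> Jcost P (optu P a) a \<le> Jcost P u a" for a
    using st by auto
  have l0: "0 \<le> lcost P x u" for x u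
  proof -
    have "ml * ((norm x)\<^sup>2 + (norm u)\<^sup>2) \<le> lcost P x u" using st by blast
    moreover have "0 \<le> ml * ((norm x)\<^sup>2 + (norm u)\<^sup>2)" using st by simp
    ultimately show ?thesis by linarith
  qed
  have V0: "0 \<le> Vcost P x" for x
  proof -
    have "mV * (norm x)\<^sup>2 \<le> Vcost P x" using st by blast
    moreover have "0 \<le> mV * (norm x)\<^sup>2" using st by simp
    ultimately show ?thesis by linarith
  qed
  have J0: "0 \<le> Jcost P u a" if "u \<in> controls P" for u a
    unfolding Jcost_def run_cost_def
    by (intro add_nonneg_nonneg V0 integral_nonneg l0 proc_integrable[OF _ continuous_l, of "hor P"])
       (use resp[OF that] in blast)
  have le: "Jopt P a \<le> Jcost P u a" if "u \<in> controls P" for u a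
    unfolding Jopt_def by (rule cINF_lower[OF bdd_belowI2[of _ 0]]) (use J0 that in auto)
  show "Jopt P (x 0) \<le> Vcost P (x (hor P)) + integral {0..hor P} (\<lambda>t. lcost P (x t) (u t))"
    if p: "process (Fdyn P) (Uset P) (hor P) x u" for x u
  proof -
    have u: "u \<in> controls P" using p piff by blast
    have eq: "resp P u (x 0) t = x t" if "t \<in> {0..hor P}" for t
      by (rule proc_unique[OF _ p _ that]) (use resp[OF u] in auto)
    have "integral {0..hor P} (\<lambda>t. lcost P (resp P u (x 0) t) (u t)) = integral {0..hor P} (\<lambda>t. lcost P (x t) (u t))"
      by (rule integral_cong) (simp add: eq)
    then have "Jcost P u (x 0) = Vcost P (x (hor P)) + integral {0..hor P} (\<lambda>t. lcost P (x t) (u t))"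
      using hor by (simp add: Jcost_def run_cost_def eq)
    then show ?thesis using le[OF u, of "x 0"] by simp
  qed
  show "process (Fdyn P) (Uset P) (hor P) (optx P a) (optu P a)" "optx P a 0 = a" for a
    using resp[OF opt(1)] by (simp_all add: optx_def)
  show "Jopt P a = Vcost P (optx P a (hor P)) + integral {0..hor P} (\<lambda>t. lcost P (optx P a t) (optu P a t))" for a
  proof -
    have "Jcost P (optu P a) a \<le> Jopt P a"
      unfolding Jopt_def by (rule cINF_greatest) (use opt in auto)
    then have "Jopt P a = Jcost P (optu P a) a" using le[OF opt(1), of a] by (intro antisym)
    then show ?thesis by (simp add: Jcost_def run_cost_def optx_def)
  qed
qed

lemma lipschitz_constsD:
  assumes "lipschitz_consts P \<alpha> dmax \<sigma>z \<sigma>\<mu> X Y Lf Lks Lk"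
  shows "0 < Lf" "0 < Lks" "0 < Lk" "\<And>x. x \<in> X \<Longrightarrow> copy P x \<in> Y"
    and "\<And>a t. a \<in> level P \<alpha> \<Longrightarrow> t \<in> {0..hor P} \<Longrightarrow> optx P a t \<in> X"
    and "\<And>d x0 k t. 0 < d \<Longrightarrow> d \<le> dmax \<Longrightarrow> active P \<alpha> d x0 k \<Longrightarrow> halts P d x0 k \<Longrightarrow> t \<in> {0..hor P} \<Longrightarrow>
       iter_x P d x0 k (q_at P d x0 k) t \<in> X \<and> xF_at P d x0 k t \<in> X"
    and "\<And>x x' u u' v v'. x \<in> X \<Longrightarrow> x' \<in> X \<Longrightarrow> u \<in> Uset P \<Longrightarrow> u' \<in> Uset P \<Longrightarrow> v \<in> Y \<Longrightarrow> v' \<in> Y \<Longrightarrow>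
       norm (fdec P x u v - fdec P x' u' v') \<le> Lf * (norm (x - x') + norm (u - u') + norm (v - v'))"
    and "\<And>x u. x \<in> X \<Longrightarrow> u \<in> Uset P \<Longrightarrow> norm (Fdyn P x u) \<le> Lf * (norm x + norm u)"
    and "\<And>x a. a \<in> level P \<alpha> \<Longrightarrow> x \<in> X \<Longrightarrow> norm (kopt P x a) \<le> Lks * norm x"
    and "\<And>a x x' z z' \<mu> \<mu>'. a \<in> level P \<alpha> \<Longrightarrow> x \<in> X \<Longrightarrow> x' \<in> X \<Longrightarrow>
       z \<in> Linf_nbhd (hor P) (ztrajs P) (optz P ` level P \<alpha>) \<sigma>z \<Longrightarrow>
       z' \<in> Linf_nbhd (hor P) (ztrajs P) (optz P ` level P \<alpha>) \<sigma>z \<Longrightarrow>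
       \<mu> \<in> Linf_nbhd (hor P) (mutrajs P) (optmu P ` level P \<alpha>) \<sigma>\<mu> \<Longrightarrow>
       \<mu>' \<in> Linf_nbhd (hor P) (mutrajs P) (optmu P ` level P \<alpha>) \<sigma>\<mu> \<Longrightarrow>
       norm (klaw P x z \<mu> a - klaw P x' z' \<mu>' a)
         \<le> Lk * (norm (x - x') + supnorm (hor P) (\<lambda>\<tau>. z \<tau> - z' \<tau>) + supnorm (hor P) (\<lambda>\<tau>. \<mu> \<tau> - \<mu>' \<tau>))"
proof -
  note * = assms[unfolded lipschitz_consts_def Let_def]
  show "0 < Lf" "0 < Lks" "0 < Lk" using * by simp_all
  show "\<And>x. x \<in> X \<Longrightarrow> copy P x \<in> Y" using * by auto
qed (use assms in \<open>simp_all add: lipschitz_consts_def Let_def\<close>)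

lemma dmpc_mpc_feedback:
  fixes P :: "('v::finite, 'n::finite, 'm::finite) dmpc"
  assumes st: "standing P ml Ml mV MV"
    and alpha: "\<alpha> = \<beta> * (1 + ml / MV * hor P)"
    and laws: "feedback_laws P \<alpha> dmax"
    and lipschitz: "lipschitz_consts P \<alpha> dmax \<sigma>z \<sigma>\<mu> X Y Lf Lks Lk"
    and terminal: "{x. Vcost P x \<le> \<beta>} \<noteq> {}" "compact {x. Vcost P x \<le> \<beta>}"
      "\<exists>\<kappa>V :: real^'n \<Rightarrow> real^'m. \<forall>x. Vcost P x \<le> \<beta> \<longrightarrow>
         \<kappa>V x \<in> Uset P \<and>
         frechet_derivative (Vcost P) (at x) (Fdyn P x (\<kappa>V x)) + lcost P x (\<kappa>V x) \<le> 0"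
    and C2: "C2_map (Jopt P)"
  obtains V' \<kappa> where
    "mpc_feedback (Fdyn P) (Uset P) (lcost P) (Vcost P) V' (hor P) \<beta> ml Ml MV \<kappa> (Jopt P) (optx P) (optu P)
       (Lhat Lf Lks) Lks (samp P)"
proof -
  interpret control_system "Fdyn P" "Uset P" "lcost P" by (rule standing_control_system[OF st])
  note opt = standing_optimal_control[OF st]
  note st = st[unfolded standing_def]
  note lip = lipschitz_constsD[OF lipschitz]
  have "C1_map (Vcost P)" using st by (intro C1_map_Vcost) blast
  then obtain V' where V': "\<And>x. (Vcost P has_derivative blinfun_apply (V' x)) (at x)" "continuous_on UNIV V'"
    unfolding C1_map_def by blast
  obtain \<kappa> where \<kappa>: "\<And>x. Vcost P x \<le> \<beta> \<Longrightarrow> \<kappa> x \<in> Uset P"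
    "\<And>x. Vcost P x \<le> \<beta> \<Longrightarrow> frechet_derivative (Vcost P) (at x) (Fdyn P x (\<kappa> x)) + lcost P x (\<kappa> x) \<le> 0"
    using terminal(3) by blast
  have VMV: "Vcost P x \<le> MV * (norm x)\<^sup>2" and lV: "mV * (norm x)\<^sup>2 \<le> Vcost P x" for x
    using st by auto
  have V0: "0 \<le> Vcost P x" for x
  proof -
    have "0 \<le> mV * (norm x)\<^sup>2" using st by simp
    then show ?thesis using lV[of x] by linarith
  qed
  have \<beta>: "0 \<le> \<beta>" using terminal(1) V0 by (auto intro: order_trans)
  \<comment> \<open>Otherwise \<open>V\<close> vanishes identically and the terminal set is the whole space.\<close>
  have "MV \<noteq> 0"
  proof
    assume "MV = 0"
    then have "{x. Vcost P x \<le> \<beta>} = UNIV" using VMV \<beta> by (auto intro: order_trans)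
    then show False using terminal(2) not_compact_UNIV by simp
  qed
  then have MV: "0 < MV" using st by simp
  have dyn0: "dyn P i 0 0 0 = 0" for i using st by blast
  have F0: "Fdyn P 0 0 = 0"
    by (simp add: Fdyn_def fdec_def copy_def dyn0 linear_simps(3)[OF bounded_linear_sblk]
        linear_simps(3)[OF bounded_linear_nblk] linear_simps(3)[OF bounded_linear_iblk])
  have in_U: "optu P a t \<in> Uset P" if "t \<in> {0..hor P}" for a t
    using proc_input[OF opt(3) that] .
  have u_fb: "norm (optu P a t) \<le> Lks * norm (optx P a t)"
    if a: "a \<in> level P \<alpha>" and t: "t \<in> {0..hor P}" for a t
  proof -
    have "optu P a t = kopt P (optx P a t) a" using laws a t unfolding feedback_laws_def by blast
    then show ?thesis using lip(9)[OF a lip(5)[OF a t]] by simp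
  qed
  have F_fb: "norm (Fdyn P (optx P a t) (optu P a t)) \<le> Lhat Lf Lks * norm (optx P a t)"
    if a: "a \<in> level P \<alpha>" and t: "t \<in> {0..hor P}" for a t
  proof -
    have "norm (Fdyn P (optx P a t) (optu P a t)) \<le> Lf * (norm (optx P a t) + norm (optu P a t))"
      by (rule lip(8)[OF lip(5)[OF a t] in_U[OF t]])
    also have "\<dots> \<le> Lf * (norm (optx P a t) + Lks * norm (optx P a t))"
      using lip(1) u_fb[OF a t] by (intro mult_left_mono) auto
    finally show ?thesis by (simp add: Lhat_def algebra_simps)
  qed
  have "mpc_feedback (Fdyn P) (Uset P) (lcost P) (Vcost P) V' (hor P) \<beta> ml Ml MV \<kappa> (Jopt P) (optx P) (optu P)
       (Lhat Lf Lks) Lks (samp P)"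
  proof
    show "0 < hor P" "0 < ml" "0 < samp P" "samp P \<le> hor P" using st by auto
    show "0 \<le> \<beta>" by (rule \<beta>)
    show "0 < MV" by (rule MV)
    show "Fdyn P 0 0 = 0" by (rule F0)
    show "(Vcost P has_derivative blinfun_apply (V' x)) (at x)" for x by (rule V'(1))
    show "continuous_on UNIV V'" by (rule V'(2))
    show "0 \<le> Vcost P x" "Vcost P x \<le> MV * (norm x)\<^sup>2" for x by (rule V0, rule VMV)
    show "ml * ((norm x)\<^sup>2 + (norm u)\<^sup>2) \<le> lcost P x u" "lcost P x u \<le> Ml * ((norm x)\<^sup>2 + (norm u)\<^sup>2)" for x u
      using st by auto
    show "\<exists>x. process (Fdyn P) (Uset P) (hor P) x (\<lambda>_. u) \<and> x 0 = a" if "u \<in> Uset P" for a u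
      using opt(1)[of "\<lambda>_. u" a] that controls_iff[OF compact_U, of "\<lambda>_. u"] by auto
    show "compact {x. Vcost P x \<le> \<beta>}" by (rule terminal(2))
    show "\<kappa> x \<in> Uset P" if "Vcost P x \<le> \<beta>" for x using \<kappa>(1)[OF that] .
    show "V' x (Fdyn P x (\<kappa> x)) + lcost P x (\<kappa> x) \<le> 0" if "Vcost P x \<le> \<beta>" for x
      using \<kappa>(2)[OF that] frechet_derivative_at[OF V'(1)[of x]] by simp
    show "Jopt P (x 0) \<le> Vcost P (x (hor P)) + integral {0..hor P} (\<lambda>t. lcost P (x t) (u t))"
      if "process (Fdyn P) (Uset P) (hor P) x u" for x u by (rule opt(2)[OF that])
    show "process (Fdyn P) (Uset P) (hor P) (optx P a) (optu P a)" "optx P a 0 = a" for a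
      by (rule opt(3), rule opt(4))
    show "Jopt P a = Vcost P (optx P a (hor P)) + integral {0..hor P} (\<lambda>t. lcost P (optx P a t) (optu P a t))" for a
      by (rule opt(5))
    show "0 < Lhat Lf Lks" using lip(1,2) by (simp add: Lhat_def)
    show "norm (Fdyn P (optx P a t) (optu P a t)) \<le> Lhat Lf Lks * norm (optx P a t)"
      "norm (optu P a t) \<le> Lks * norm (optx P a t)"
      if "Jopt P a \<le> \<beta> * (1 + ml / MV * hor P)" "t \<in> {0..hor P}" for a t
      using F_fb[of a t] u_fb[of a t] that by (simp_all add: level_def alpha)
    show "C2_map (Jopt P)" by (rule C2)
  qed
  then show ?thesis by (rule that)
qed

section \<open>Prediction error of one step of the closed loop\<close>

lemma norm_le_supnorm:
  assumes "\<And>t. t \<in> {0..T} \<Longrightarrow> norm (g t) \<le> B" "t \<in> {0..T}"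
  shows "norm (g t) \<le> supnorm T g"
  unfolding supnorm_def by (rule cSUP_upper[OF assms(2)]) (rule bdd_aboveI2[of _ _ B], rule assms(1))

lemma supnorm_le:
  assumes "0 \<le> T" "\<And>t. t \<in> {0..T} \<Longrightarrow> norm (g t) \<le> B"
  shows "supnorm T g \<le> B"
  unfolding supnorm_def by (rule cSUP_least) (use assms in auto)

lemma Linf_norm_bound:
  assumes "g \<in> Linf T A"
  obtains B where "\<And>t. t \<in> {0..T} \<Longrightarrow> norm (g t) \<le> B"
proof -
  have "bounded (g ` {0..T})" using assms by (simp add: Linf_def)
  then obtain B where "\<forall>y\<in>g ` {0..T}. norm y \<le> B" unfolding bounded_iff by (elim exE)
  then show ?thesis by (intro that[of B]) simp
qed

lemma norm_fst_le_norm: "norm (fst p) \<le> norm p"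
  by (metis norm_fst_le prod.collapse)

lemma norm_snd_le_norm: "norm (snd p) \<le> norm p"
  by (metis norm_snd_le prod.collapse)

lemma norm_sblk_le: "norm (sblk P i x) \<le> norm x"
  by (rule norm_le_componentwise_cart) (simp add: sblk_def)

lemma norm_nblk_le: "norm (nblk P i x) \<le> norm x"
  by (rule norm_le_componentwise_cart) (simp add: nblk_def)

text \<open>The stopping criterion bounds the increments agent by agent; summing over the agents bounds them as
  a whole.\<close>
lemma stops_imp_small_increment:
  fixes P :: "('v::finite, 'n::finite, 'm::finite) dmpc"
  assumes d: "0 \<le> d" and stop: "stops P d a s q"
    and z: "fst (admm P a s q) \<in> ztrajs P" "fst (admm P a s (q - 1)) \<in> ztrajs P"
    and \<mu>: "snd (admm P a s q) \<in> mutrajs P" "snd (admm P a s (q - 1)) \<in> mutrajs P"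
    and t: "t \<in> {0..hor P}"
  shows "norm (fst (admm P a s q) t - fst (admm P a s (q - 1)) t,
               snd (admm P a s q) t - snd (admm P a s (q - 1)) t) \<le> 3 * real CARD('v) * d * norm a"
proof -
  define dz where "dz t = fst (admm P a s q) t - fst (admm P a s (q - 1)) t" for t
  define d\<mu> where "d\<mu> t = snd (admm P a s q) t - snd (admm P a s (q - 1)) t" for t
  have bd: "\<exists>B. \<forall>t\<in>{0..hor P}. norm (g t - h t) \<le> B"
    if g: "g \<in> Linf (hor P) A" "h \<in> Linf (hor P) A" for g h :: "real \<Rightarrow> 'b::euclidean_space" and A
  proof -
    obtain B1 where "\<And>t. t \<in> {0..hor P} \<Longrightarrow> norm (g t) \<le> B1" using Linf_norm_bound[OF g(1)] by metis
    moreover obtain B2 where "\<And>t. t \<in> {0..hor P} \<Longrightarrow> norm (h t) \<le> B2" using Linf_norm_bound[OF g(2)] by metis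
    ultimately have "\<forall>t\<in>{0..hor P}. norm (g t - h t) \<le> B1 + B2"
      by (meson add_mono norm_triangle_ineq4 order_trans)
    then show ?thesis by blast
  qed
  obtain B1 where B1: "\<And>t. t \<in> {0..hor P} \<Longrightarrow> norm (dz t) \<le> B1"
    using bd[OF z[unfolded ztrajs_def]] unfolding dz_def by blast
  obtain B2 where B2: "\<And>t. t \<in> {0..hor P} \<Longrightarrow> norm (d\<mu> t) \<le> B2"
    using bd[OF \<mu>[unfolded mutrajs_def]] unfolding d\<mu>_def by blast
  let ?g = "\<lambda>i t. (sblk P i (dz t), sblk P i (fst (d\<mu> t)), nblk P i (snd (d\<mu> t) $ i))"
  have g: "norm (?g i t) \<le> d * norm a" for i
  proof -
    have "norm (?g i r) \<le> B1 + (B2 + B2)" if r: "r \<in> {0..hor P}" for r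
    proof -
      have "norm (sblk P i (fst (d\<mu> r))) \<le> B2"
        using norm_sblk_le[of P i "fst (d\<mu> r)"] norm_fst_le_norm[of "d\<mu> r"] B2[OF r] by linarith
      moreover have "norm (nblk P i (snd (d\<mu> r) $ i)) \<le> B2"
        using norm_nblk_le[of P i "snd (d\<mu> r) $ i"] norm_snd_le_norm[of "d\<mu> r"] B2[OF r]
          Finite_Cartesian_Product.norm_nth_le[where x = "snd (d\<mu> r)" and i = i] by linarith
      moreover have "norm (sblk P i (dz r)) \<le> B1"
        using norm_sblk_le[of P i "dz r"] B1[OF r] by linarith
      ultimately show ?thesis
        by (intro order_trans[OF norm_Pair_le] add_mono)
    qed
    then have "norm (?g i t) \<le> supnorm (hor P) (?g i)" by (rule norm_le_supnorm[OF _ t])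
    also have "\<dots> \<le> d * norm (sblk P i a)"
      using stop by (simp add: stops_def Let_def dz_def d\<mu>_def)
    also have "\<dots> \<le> d * norm a" by (rule mult_left_mono[OF norm_sblk_le d])
    finally show ?thesis .
  qed
  have g1: "norm (sblk P i (dz t)) \<le> d * norm a" for i
    using norm_fst_le_norm[of "?g i t"] g[of i] by simp
  have g2: "norm (sblk P i (fst (d\<mu> t))) \<le> d * norm a" for i
    using norm_snd_le_norm[of "?g i t"] norm_fst_le_norm[of "snd (?g i t)"] g[of i] by simp
  have g3: "norm (nblk P i (snd (d\<mu> t) $ i)) \<le> d * norm a" for i
    using norm_snd_le_norm[of "?g i t"] norm_snd_le_norm[of "snd (?g i t)"] g[of i] by simp
  have "norm (\<Sum>i\<in>UNIV. sblk P i (dz t)) \<le> (\<Sum>i\<in>(UNIV::'v set). d * norm a)"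
    by (rule sum_norm_le) (rule g1)
  then have 1: "norm (dz t) \<le> real CARD('v) * d * norm a" by (simp add: sum_sblk)
  have "norm (\<Sum>i\<in>UNIV. sblk P i (fst (d\<mu> t))) \<le> (\<Sum>i\<in>(UNIV::'v set). d * norm a)"
    by (rule sum_norm_le) (rule g2)
  then have 2: "norm (fst (d\<mu> t)) \<le> real CARD('v) * d * norm a" by (simp add: sum_sblk)
  have cp: "nblk P i (snd (d\<mu> t) $ i) = snd (d\<mu> t) $ i" for i
    using \<mu> t by (auto simp: d\<mu>_def mutrajs_def Linf_def copies_def image_subset_iff mem_Times_iff
        linear_simps(2)[OF bounded_linear_nblk])
  have "norm (snd (d\<mu> t)) \<le> (\<Sum>i\<in>UNIV. norm (snd (d\<mu> t) $ i))"
    unfolding norm_vec_def by (rule L2_set_le_sum) simp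
  also have "\<dots> \<le> (\<Sum>i\<in>(UNIV::'v set). d * norm a)"
    using g3 cp by (intro sum_mono) metis
  finally have 3: "norm (snd (d\<mu> t)) \<le> real CARD('v) * d * norm a" by simp
  have "norm (dz t, d\<mu> t) \<le> norm (dz t) + norm (d\<mu> t)" by (rule norm_Pair_le)
  also have "norm (d\<mu> t) \<le> norm (fst (d\<mu> t)) + norm (snd (d\<mu> t))"
    using norm_Pair_le[of "fst (d\<mu> t)" "snd (d\<mu> t)"] by simp
  finally show ?thesis using 1 2 3 by (simp add: dz_def d\<mu>_def)
qed

text \<open>Linear convergence turns the small increment of the last iteration into a small distance to the
  optimal coordination variables and multipliers. The multiplier update shows that the decoupled state
  nearly satisfies the consistency constraint, so it is also near the optimal state, and by the
  Lipschitz property of the feedback law the applied input is near the optimal input.\<close>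
lemma closed_loop_prediction_error:
  fixes P :: "('v::finite, 'n::finite, 'm::finite) dmpc"
  assumes st: "standing P ml Ml mV MV"
    and exact: "admm_exact P \<alpha> dmax"
    and laws: "feedback_laws P \<alpha> dmax"
    and lipschitz: "lipschitz_consts P \<alpha> dmax \<sigma>z \<sigma>\<mu> X Y Lf Lks Lk"
    and opt_mu: "\<And>a. a \<in> level P \<alpha> \<Longrightarrow> optmu P a \<in> mutrajs P"
    and \<sigma>: "0 < \<sigma>\<mu>" "0 < \<sigma>z"
    and nbhd: "\<And>d x0 k q. 0 < d \<Longrightarrow> d \<le> dmax \<Longrightarrow> active P \<alpha> d x0 k \<Longrightarrow>
         iter_mu P d x0 k q \<in> Linf_nbhd (hor P) (mutrajs P) (optmu P ` level P \<alpha>) \<sigma>\<mu> \<and>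
         iter_z P d x0 k q \<in> Linf_nbhd (hor P) (ztrajs P) (optz P ` level P \<alpha>) \<sigma>z"
    and C: "0 \<le> C" "C < 1"
    and conv: "\<And>d x0 k q. 0 < d \<Longrightarrow> d \<le> dmax \<Longrightarrow> active P \<alpha> d x0 k \<Longrightarrow> 1 \<le> q \<Longrightarrow>
         supnorm (hor P) (\<lambda>\<tau>. (iter_z P d x0 k q \<tau> - optz P (state_at P d x0 k) \<tau>,
                               iter_mu P d x0 k q \<tau> - optmu P (state_at P d x0 k) \<tau>))
         \<le> C * supnorm (hor P) (\<lambda>\<tau>. (iter_z P d x0 k (q - 1) \<tau> - optz P (state_at P d x0 k) \<tau>,
                                     iter_mu P d x0 k (q - 1) \<tau> - optmu P (state_at P d x0 k) \<tau>))"
  obtains D where "0 \<le> D"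
    "\<And>d x0 k t. 0 < d \<Longrightarrow> d \<le> dmax \<Longrightarrow> active P \<alpha> d x0 k \<Longrightarrow> halts P d x0 k \<Longrightarrow> t \<in> {0..hor P} \<Longrightarrow>
       norm (xF_at P d x0 k t - optx P (state_at P d x0 k) t) \<le> D * d * norm (state_at P d x0 k)"
proof -
  interpret control_system "Fdyn P" "Uset P" "lcost P" by (rule standing_control_system[OF st])
  note opt = standing_optimal_control[OF st]
  note lip = lipschitz_constsD[OF lipschitz]
  have T: "0 < hor P" and pen: "0 < pen P" using st by (auto simp: standing_def)
  obtain cb where cb: "0 < cb" "\<And>y. norm (copy P y) \<le> norm y * cb"
    using bounded_linear.pos_bounded[OF bounded_linear_copy] by blast
  define G where "G = 3 * real CARD('v)"
  define H where "H = Lk * (G * (1 / pen P + 3 / (1 - C)))"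
  have G: "0 \<le> G" by (simp add: G_def)
  have H: "0 \<le> H" using lip(3) G pen C by (simp add: H_def)
  define B where "B = Lf * (1 + cb)"
  have B: "0 \<le> B" using lip(1) cb(1) by (simp add: B_def)
  define D where "D = Lf * H * hor P * exp (B * hor P)"
  have D: "0 \<le> D" using lip(1) H T by (simp add: D_def)
  have "norm (xF_at P d x0 k t - optx P (state_at P d x0 k) t) \<le> D * d * norm (state_at P d x0 k)"
    if d: "0 < d" "d \<le> dmax" and act: "active P \<alpha> d x0 k" and halt: "halts P d x0 k" and t: "t \<in> {0..hor P}"
    for d x0 k t
  proof -
    define a where "a = state_at P d x0 k"
    define s where "s = start_at P d x0 k"
    define q where "q = q_at P d x0 k"
    define p where "p = q - 1"
    define z where "z j = iter_z P d x0 k j" for j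
    define \<mu> where "\<mu> j = iter_mu P d x0 k j" for j
    define w where "w = iter_w P d x0 k q"
    define x where "x = iter_x P d x0 k q"
    have a: "a \<in> level P \<alpha>" using act by (simp add: active_def a_def)
    have "\<exists>q. stops P d a s q" using halt by (simp add: halts_def a_def s_def)
    then have "stops P d a s (LEAST q. stops P d a s q)" by (rule LeastI_ex)
    then have stop: "stops P d a s q" by (simp add: q_def q_at_def stop_index_def a_def s_def)
    then have q1: "1 \<le> q" by (simp add: stops_def)
    then have q: "q = Suc p" by (simp add: p_def)
    have z_def': "z j = fst (admm P a s j)" and \<mu>_def': "\<mu> j = snd (admm P a s j)" for j
      by (simp_all add: z_def \<mu>_def iter_z_def iter_mu_def a_def s_def)
    have \<mu>n: "\<mu> j \<in> Linf_nbhd (hor P) (mutrajs P) (optmu P ` level P \<alpha>) \<sigma>\<mu>"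
      and zn: "z j \<in> Linf_nbhd (hor P) (ztrajs P) (optz P ` level P \<alpha>) \<sigma>z" for j
      using nbhd[OF d act, of j] by (simp_all add: z_def \<mu>_def)
    have \<mu>j: "\<mu> j \<in> mutrajs P" and zj: "z j \<in> ztrajs P" for j
      using \<mu>n[of j] zn[of j] by (simp_all add: Linf_nbhd_def)
    have oz: "optz P a \<in> ztrajs P"
    proof -
      have c: "continuous_on {0..hor P} (optz P a)" using proc_continuous[OF opt(3)] by (simp add: optz_def)
      then have "optz P a \<in> borel_measurable (lebesgue_on {0..hor P})"
        by (rule continuous_imp_measurable_on_sets_lebesgue) auto
      moreover have "bounded (optz P a ` {0..hor P})"
        by (rule compact_imp_bounded[OF compact_continuous_image[OF c compact_Icc]])
      ultimately show ?thesis by (simp add: ztrajs_def Linf_def)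
    qed
    have self: "supnorm (hor P) (\<lambda>t. 0 :: 'c::real_normed_vector) \<le> r" if "0 < r" for r
      by (rule supnorm_le) (use T that in auto)
    have ozn: "optz P a \<in> Linf_nbhd (hor P) (ztrajs P) (optz P ` level P \<alpha>) \<sigma>z"
      using oz a self[OF \<sigma>(2)] by (auto simp: Linf_nbhd_def intro!: bexI[of _ a])
    have o\<mu>n: "optmu P a \<in> Linf_nbhd (hor P) (mutrajs P) (optmu P ` level P \<alpha>) \<sigma>\<mu>"
      using opt_mu[OF a] a self[OF \<sigma>(1)] by (auto simp: Linf_nbhd_def intro!: bexI[of _ a])
    define \<eta> where "\<eta> = G * d * norm a"
    have incr: "norm (z q r - z p r, \<mu> q r - \<mu> p r) \<le> \<eta>" if "r \<in> {0..hor P}" for r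
      using stops_imp_small_increment[OF _ stop _ _ _ _ that] zj \<mu>j d(1)
      by (simp add: z_def' \<mu>_def' \<eta>_def G_def p_def)
    have \<eta>0: "0 \<le> \<eta>" using G d by (simp add: \<eta>_def)
    define g where "g j = (\<lambda>r. (z j r - optz P a r, \<mu> j r - optmu P a r))" for j
    define e where "e j = supnorm (hor P) (g j)" for j
    have ge: "norm (g j r) \<le> e j" if r: "r \<in> {0..hor P}" for j r
    proof -
      obtain B1 where B1: "\<And>r. r \<in> {0..hor P} \<Longrightarrow> norm (z j r) \<le> B1"
        using Linf_norm_bound[OF zj[unfolded ztrajs_def]] by metis
      obtain B2 where B2: "\<And>r. r \<in> {0..hor P} \<Longrightarrow> norm (optz P a r) \<le> B2"
        using Linf_norm_bound[OF oz[unfolded ztrajs_def]] by metis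
      obtain B3 where B3: "\<And>r. r \<in> {0..hor P} \<Longrightarrow> norm (\<mu> j r) \<le> B3"
        using Linf_norm_bound[OF \<mu>j[unfolded mutrajs_def]] by metis
      obtain B4 where B4: "\<And>r. r \<in> {0..hor P} \<Longrightarrow> norm (optmu P a r) \<le> B4"
        using Linf_norm_bound[OF opt_mu[OF a, unfolded mutrajs_def]] by metis
      have "norm (g j r) \<le> (B1 + B2) + (B3 + B4)" if r: "r \<in> {0..hor P}" for r
        unfolding g_def
        by (intro order_trans[OF norm_Pair_le] add_mono order_trans[OF norm_triangle_ineq4]
            B1[OF r] B2[OF r] B3[OF r] B4[OF r])
      then show ?thesis unfolding e_def by (rule norm_le_supnorm[OF _ r])
    qed
    have e0: "0 \<le> e p" using ge[of 0 p] T norm_ge_zero[of "g p 0"] by (auto simp del: norm_ge_zero)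
    have eq: "e q \<le> C * e p"
      using conv[OF d act q1] by (simp add: e_def g_def z_def \<mu>_def a_def p_def)
    define E where "E = \<eta> / (1 - C)"
    have "e p \<le> \<eta> + C * e p"
      unfolding e_def[of p]
    proof (rule supnorm_le)
      fix r assume r: "r \<in> {0..hor P}"
      have "g p r = g q r - (z q r - z p r, \<mu> q r - \<mu> p r)" by (simp add: g_def)
      then have "norm (g p r) \<le> norm (g q r) + norm (z q r - z p r, \<mu> q r - \<mu> p r)"
        by (metis norm_triangle_ineq4)
      then show "norm (g p r) \<le> \<eta> + C * supnorm (hor P) (g p)"
        using ge[OF r, of q] eq incr[OF r] by (simp add: e_def)
    qed (use T in simp)
    then have ep: "e p \<le> E" using C by (simp add: E_def field_simps)
    moreover have "C * e p \<le> 1 * e p" by (rule mult_right_mono) (use C e0 in auto)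
    ultimately have eqE: "e q \<le> E" using eq by linarith
    have zE: "norm (z j r - optz P a r) \<le> e j" and \<mu>E: "norm (\<mu> j r - optmu P a r) \<le> e j"
      if "r \<in> {0..hor P}" for j r
      using ge[OF that, of j] norm_fst_le[of "z j r - optz P a r" "\<mu> j r - optmu P a r"]
        norm_snd_le[of "\<mu> j r - optmu P a r" "z j r - optz P a r"] by (simp_all add: g_def)
    \<comment> \<open>The multiplier increment is the penalty times the violation of consistency.\<close>
    have upd: "fst (\<mu> q r) - fst (\<mu> p r) = pen P *\<^sub>R (z q r - x r)" for r
      by (simp add: \<mu>_def' z_def' q mu_update_def Let_def x_def iter_x_def iter_w_def admm_w_def
          flip: a_def s_def)
    have xz: "norm (z q r - x r) \<le> \<eta> / pen P" if r: "r \<in> {0..hor P}" for r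
    proof -
      have "pen P * norm (z q r - x r) = norm (fst (\<mu> q r - \<mu> p r))"
        using pen by (simp add: upd)
      also have "\<dots> \<le> norm (\<mu> q r - \<mu> p r)"
        by (rule norm_fst_le_norm)
      also have "\<dots> \<le> \<eta>"
        using norm_snd_le[of "\<mu> q r - \<mu> p r" "z q r - z p r"] incr[OF r] by linarith
      finally show ?thesis using pen by (simp add: field_simps)
    qed
    have xo: "norm (x r - optx P a r) \<le> \<eta> / pen P + E" if r: "r \<in> {0..hor P}" for r
    proof -
      have "norm (x r - optx P a r) \<le> norm (x r - z q r) + norm (z q r - optx P a r)"
        by (rule norm_triangle_sub[of "x r - optx P a r" "z q r - optx P a r", simplified, THEN order_trans]) simp
      then show ?thesis
        using xz[OF r] zE[OF r, of q] eqE by (simp add: optz_def norm_minus_commute)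
    qed
    define c where "c = H * d * norm a"
    have u: "norm (fst w r - optu P a r) \<le> c" if r: "r \<in> {0..hor P}" for r
    proof -
      have 1: "fst w r = klaw P (x r) (z p) (\<mu> p) a"
        using laws d act halt r
        unfolding feedback_laws_def Let_def w_def x_def z_def \<mu>_def a_def q_def p_def by blast
      have 2: "optu P a r = klaw P (optx P a r) (optz P a) (optmu P a) a"
        using laws a r unfolding feedback_laws_def by metis
      have "norm (fst w r - optu P a r) \<le> Lk * (norm (x r - optx P a r)
          + supnorm (hor P) (\<lambda>\<tau>. z p \<tau> - optz P a \<tau>) + supnorm (hor P) (\<lambda>\<tau>. \<mu> p \<tau> - optmu P a \<tau>))"
        unfolding 1 2
        by (rule lip(10)[OF a _ lip(5)[OF a r] zn ozn \<mu>n o\<mu>n])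
           (use lip(6)[OF d act halt r] in \<open>simp add: x_def q_def\<close>)
      also have "\<dots> \<le> Lk * ((\<eta> / pen P + E) + E + E)"
      proof (intro mult_left_mono add_mono xo[OF r])
        show "supnorm (hor P) (\<lambda>\<tau>. z p \<tau> - optz P a \<tau>) \<le> E"
          by (rule supnorm_le) (use T order_trans[OF zE ep] in auto)
        show "supnorm (hor P) (\<lambda>\<tau>. \<mu> p \<tau> - optmu P a \<tau>) \<le> E"
          by (rule supnorm_le) (use T order_trans[OF \<mu>E ep] in auto)
      qed (use lip(3) in simp)
      also have "\<dots> = c"
        by (simp add: c_def H_def E_def \<eta>_def algebra_simps)
      finally show ?thesis .
    qed
    have "is_argw P (z p) (\<mu> p) a w"
      using exact d act q1 unfolding admm_exact_def z_def \<mu>_def a_def w_def p_def by blast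
    then have wc: "fst w \<in> controls P" by (simp add: is_argw_def wtrajs_def)
    have xF: "xF_at P d x0 k = resp P (fst w) a"
      by (simp add: xF_at_def xF_def w_def iter_w_def a_def q_def)
    have pF: "proc (hor P) (xF_at P d x0 k) (fst w)" "xF_at P d x0 k 0 = a"
      using opt(1)[OF wc, of a] by (simp_all add: xF)
    have "norm (xF_at P d x0 k t - optx P a t) \<le> Lf * c * hor P * exp (B * t)"
    proof (rule proc_distance[OF pF(1) opt(3) _ B _ t])
      show "xF_at P d x0 k 0 = optx P a 0" using pF(2) opt(4) by simp
      fix r assume r: "r \<in> {0..hor P}"
      let ?y = "xF_at P d x0 k r" and ?o = "optx P a r"
      have y: "?y \<in> X" and o: "?o \<in> X" using lip(6)[OF d act halt r] lip(5)[OF a r] by auto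
      have "norm (Fdyn P ?y (fst w r) - Fdyn P ?o (optu P a r))
          \<le> Lf * (norm (?y - ?o) + norm (fst w r - optu P a r) + norm (copy P ?y - copy P ?o))"
        unfolding Fdyn_def
        by (rule lip(7)[OF y o proc_input[OF pF(1) r] proc_input[OF opt(3) r] lip(4)[OF y] lip(4)[OF o]])
      also have "\<dots> \<le> Lf * (norm (?y - ?o) + c + norm (?y - ?o) * cb)"
        using cb(2)[of "?y - ?o"] lip(1) u[OF r]
        by (intro mult_left_mono add_mono) (auto simp: linear_simps(2)[OF bounded_linear_copy])
      also have "\<dots> = B * norm (?y - ?o) + Lf * c" by (simp add: B_def algebra_simps)
      finally show "norm (Fdyn P ?y (fst w r) - Fdyn P ?o (optu P a r)) \<le> B * norm (?y - ?o) + Lf * c" .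
    qed
    also have "\<dots> \<le> Lf * c * hor P * exp (B * hor P)"
      using lip(1) H d T t B by (intro mult_left_mono) (auto simp: c_def intro: mult_left_mono)
    also have "\<dots> = D * d * norm a" by (simp add: D_def c_def)
    finally show ?thesis by (simp add: a_def)
  qed
  with D show ?thesis using that by blast
qed

section \<open>Exponential stability of the closed loop\<close>

lemma exp_decay_onI:
  assumes "0 < c" "0 < \<theta>" "\<theta> < 1" "\<And>x0 k. x0 \<in> A \<Longrightarrow> R x0 k \<Longrightarrow> a x0 k \<le> c * \<theta> ^ k"
  shows "exp_decay_on A R a"
  using assms unfolding exp_decay_on_def by blast

lemma mJ_le_MJ:
  assumes "0 < L" "0 < T" "0 < ml" "ml \<le> Ml" "0 \<le> MV"
  shows "mJ ml L T \<le> MJ MV Ml Lks L T" "0 < MJ MV Ml Lks L T"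
proof -
  define y where "y = exp (2 * L * T)"
  have y: "1 < y" using assms by (simp add: y_def)
  have "1 - 1 / y \<le> y - 1"
  proof -
    have "0 \<le> (y - 1) * (y - 1) / y" using y by simp
    also have "\<dots> = (y - 1) - (1 - 1 / y)" using y by (simp add: field_simps)
    finally show ?thesis by simp
  qed
  then have "ml / (2 * L) * (1 - 1 / y) \<le> Ml / (2 * L) * (y - 1)"
    using assms y by (intro mult_mono divide_right_mono) auto
  also have "\<dots> = Ml / (2 * L) * 1 * (y - 1)" by simp
  also have "\<dots> \<le> Ml / (2 * L) * (1 + Lks\<^sup>2) * (y - 1)"
    using assms y by (intro mult_right_mono mult_left_mono) auto
  also have "\<dots> \<le> MV * y + \<dots>" using assms y by simp
  finally show "mJ ml L T \<le> MJ MV Ml Lks L T"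
    by (simp add: mJ_def MJ_def y_def exp_minus field_simps)
  have "0 < Ml / (2 * L) * (1 + Lks\<^sup>2) * (y - 1)"
    using assms y by (intro mult_pos_pos divide_pos_pos add_pos_nonneg) auto
  moreover have "0 \<le> MV * y" using assms y by simp
  ultimately show "0 < MJ MV Ml Lks L T" by (simp add: MJ_def y_def)
qed

text \<open>In the definition of \<open>alpha_hat\<close> the numerator \<open>mJ\<close> is at most \<open>MJ\<close>, and the squared factor
  is at least \<open>1\<close>.\<close>
lemma alpha_hat_le:
  fixes P :: "('v::finite, 'n::finite, 'm::finite) dmpc"
  assumes st: "standing P ml Ml mV MV" and L: "0 < Lf" "0 < Lks" "0 < Lk" and C: "C < 1"
    and \<alpha>: "0 \<le> \<alpha>" and d: "0 \<le> d"
  shows "alpha_hat P ml Ml MV Lf Lks Lk C \<alpha> d \<le> \<alpha>"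
proof -
  define Lh where "Lh = Lhat Lf Lks"
  have Lh: "0 < Lh" using L by (simp add: Lh_def Lhat_def)
  have T: "0 < hor P" "0 < samp P" "0 < pen P" "0 < ml" "0 \<le> MV" using st by (auto simp: standing_def)
  obtain x :: "real^'n" where x: "norm x = 1" using vector_choose_size[of 1] by auto
  have "ml * ((norm x)\<^sup>2 + (norm (0::real^'m))\<^sup>2) \<le> Ml * ((norm x)\<^sup>2 + (norm (0::real^'m))\<^sup>2)"
    using st unfolding standing_def by (meson order_trans)
  then have ml: "ml \<le> Ml" using x by simp
  note J = mJ_le_MJ[OF Lh T(1,4) ml T(5)]
  define K1 where "K1 = (Lf * (2 * sqrt (real (pdim P)) / pen P) + 2 * Lk / (1 - C)) * real CARD('v)"
  have K1: "0 \<le> K1" using L T C by (simp add: K1_def)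
  have "0 \<le> Dconst P Lf Lk C"
    using L T K1 unfolding Dconst_def Let_def K1_def[symmetric]
    by (intro add_nonneg_nonneg mult_nonneg_nonneg divide_nonneg_nonneg) auto
  then have "1 \<le> exp (Lh * samp P) + Dconst P Lf Lk C * d"
    using Lh T d one_le_exp_iff[of "Lh * samp P"] by (smt (verit) mult_nonneg_nonneg)
  then have sq: "1 \<le> (exp (Lh * samp P) + Dconst P Lf Lk C * d)\<^sup>2" (is "1 \<le> ?s") by simp
  have "mJ ml Lh (hor P) * \<alpha> \<le> MJ MV Ml Lks Lh (hor P) * ?s * \<alpha>"
  proof (rule mult_right_mono[OF order_trans[OF J(1)] \<alpha>])
    show "MJ MV Ml Lks Lh (hor P) \<le> MJ MV Ml Lks Lh (hor P) * ?s"
      using mult_left_mono[OF sq less_imp_le[OF J(2)[of Lks]]] by (simp only: mult_1_right)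
  qed
  moreover have "0 < MJ MV Ml Lks Lh (hor P) * ?s" using sq by (intro mult_pos_pos J(2)) linarith
  ultimately show ?thesis
    by (simp add: alpha_hat_def Let_def pos_divide_le_eq mult.commute flip: Lh_def)
qed

theorem theorem2:
  fixes P :: "('v::finite, 'n::finite, 'm::finite) dmpc"
    and ml Ml mV MV \<alpha> \<beta> Lf Lks Lk C \<sigma>z \<sigma>\<mu> dmax :: real
    and X :: "(real^'n) set" and Y :: "(real^'n^'v) set"
  assumes standing: "standing P ml Ml mV MV"
    and alpha: "\<alpha> = \<beta> * (1 + ml / MV * hor P)"
    and compact_sets:
      "optz P ` level P \<alpha> \<noteq> {}" "Linf_compact (hor P) (optz P ` level P \<alpha>)"
      "optmu P ` level P \<alpha> \<noteq> {}" "Linf_compact (hor P) (optmu P ` level P \<alpha>)"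
    and dmax: "0 < dmax"
    and exact: "admm_exact P \<alpha> dmax"
    and laws: "feedback_laws P \<alpha> dmax"
    and lipschitz: "lipschitz_consts P \<alpha> dmax \<sigma>z \<sigma>\<mu> X Y Lf Lks Lk"
    and hyp1:
      "{x. Vcost P x \<le> \<beta>} \<noteq> {}" "compact {x. Vcost P x \<le> \<beta>}"
      "\<exists>\<kappa>V :: real^'n \<Rightarrow> real^'m. \<forall>x. Vcost P x \<le> \<beta> \<longrightarrow>
         \<kappa>V x \<in> Uset P \<and>
         frechet_derivative (Vcost P) (at x) (Fdyn P x (\<kappa>V x)) + lcost P x (\<kappa>V x) \<le> 0"
    and hyp2:
      "C2_map (Jopt P)"
      "loc_lipschitz dist dist (UNIV \<times> level P \<alpha>) (\<lambda>(x, xk). kopt P x xk)"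
      "loc_lipschitz
         (\<lambda>(x, z, \<mu>, xk) (x', z', \<mu>', xk').
            dist x x' + supnorm (hor P) (\<lambda>\<tau>. z \<tau> - z' \<tau>)
            + supnorm (hor P) (\<lambda>\<tau>. \<mu> \<tau> - \<mu>' \<tau>) + dist xk xk')
         dist
         (UNIV \<times> ztrajs P \<times> mutrajs P \<times> level P \<alpha>)
         (\<lambda>(x, z, \<mu>, xk). klaw P x z \<mu> xk)"
    and hyp3:
      "\<And>xk. xk \<in> level P \<alpha> \<Longrightarrow> optmu P xk \<in> mutrajs P \<and> saddle P xk (optmu P xk)"
      "\<And>xk \<mu>. xk \<in> level P \<alpha> \<Longrightarrow> \<mu> \<in> mutrajs P \<Longrightarrow> saddle P xk \<mu> \<Longrightarrow>
         AE \<tau> in lebesgue_on {0..hor P}. \<mu> \<tau> = optmu P xk \<tau>"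
      "loc_lipschitz dist (\<lambda>g h. supnorm (hor P) (\<lambda>\<tau>. g \<tau> - h \<tau>)) (level P \<alpha>) (optmu P)"
      "loc_lipschitz dist (\<lambda>g h. supnorm (hor P) (\<lambda>\<tau>. g \<tau> - h \<tau>)) (level P \<alpha>) (optz P)"
    and hyp4:
      "0 < \<sigma>\<mu>" "0 < \<sigma>z"
      "\<And>d x0 k q. 0 < d \<Longrightarrow> d \<le> dmax \<Longrightarrow> active P \<alpha> d x0 k \<Longrightarrow>
         iter_mu P d x0 k q \<in> Linf_nbhd (hor P) (mutrajs P) (optmu P ` level P \<alpha>) \<sigma>\<mu> \<and>
         iter_z P d x0 k q \<in> Linf_nbhd (hor P) (ztrajs P) (optz P ` level P \<alpha>) \<sigma>z"
    and hyp5: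
      "0 \<le> C" "C < 1"
      "\<And>d x0 k q. 0 < d \<Longrightarrow> d \<le> dmax \<Longrightarrow> active P \<alpha> d x0 k \<Longrightarrow> 1 \<le> q \<Longrightarrow>
         supnorm (hor P) (\<lambda>\<tau>. (iter_z P d x0 k q \<tau> - optz P (state_at P d x0 k) \<tau>,
                               iter_mu P d x0 k q \<tau> - optmu P (state_at P d x0 k) \<tau>))
         \<le> C * supnorm (hor P) (\<lambda>\<tau>. (iter_z P d x0 k (q - 1) \<tau> - optz P (state_at P d x0 k) \<tau>,
                                     iter_mu P d x0 k (q - 1) \<tau> - optmu P (state_at P d x0 k) \<tau>))"
  shows "\<exists>d. 0 < d \<and> d \<le> dmax \<and>
    (let A = level P (alpha_hat P ml Ml MV Lf Lks Lk C \<alpha> d) in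
     exp_decay_on A (\<lambda>x0 k. \<forall>j<k. halts P d x0 j) (\<lambda>x0 k. Jopt P (state_at P d x0 k)) \<and>
     exp_decay_on A (\<lambda>x0 k. \<forall>j\<le>k. halts P d x0 j) (\<lambda>x0 k. err_norm P d x0 k) \<and>
     (\<exists>\<gamma>1 \<gamma>2. 0 < \<gamma>1 \<and> 0 < \<gamma>2 \<and>
        (\<forall>x0\<in>A. \<forall>t\<ge>0. (\<forall>j\<le>nat \<lfloor>t / samp P\<rfloor>. halts P d x0 j) \<longrightarrow>
           norm (plant_state P d x0 t) \<le> \<gamma>1 * exp (- \<gamma>2 * t))))"
proof -
  obtain V' \<kappa> where "mpc_feedback (Fdyn P) (Uset P) (lcost P) (Vcost P) V' (hor P) \<beta> ml Ml MV \<kappa>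
      (Jopt P) (optx P) (optu P) (Lhat Lf Lks) Lks (samp P)"
    by (rule dmpc_mpc_feedback[OF standing alpha laws lipschitz hyp1 hyp2(1)])
  then interpret M: mpc_feedback "Fdyn P" "Uset P" "lcost P" "Vcost P" V' "hor P" \<beta> ml Ml MV \<kappa>
      "Jopt P" "optx P" "optu P" "Lhat Lf Lks" Lks "samp P" .
  have M\<alpha>: "M.\<alpha> = \<alpha>" by (simp add: M.\<alpha>_def alpha)
  note \<alpha>0 = M.\<alpha>_nonneg[unfolded M\<alpha>]
  have T: "0 < hor P" and samp: "0 < samp P" "samp P \<le> hor P" using standing by (auto simp: standing_def)
  note L = lipschitz_constsD(1-3)[OF lipschitz]
  obtain D where D: "0 \<le> D"
    and err: "\<And>d x0 k t. 0 < d \<Longrightarrow> d \<le> dmax \<Longrightarrow> active P \<alpha> d x0 k \<Longrightarrow> halts P d x0 k \<Longrightarrow> t \<in> {0..hor P} \<Longrightarrow>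
       norm (xF_at P d x0 k t - optx P (state_at P d x0 k) t) \<le> D * d * norm (state_at P d x0 k)"
    using closed_loop_prediction_error[OF standing exact laws lipschitz _ hyp4(1,2,3) hyp5] hyp3(1) by blast
  obtain d0 \<theta> where d0: "0 < d0" and \<theta>: "0 < \<theta>" "\<theta> < 1"
    and decrease: "\<And>d a y. 0 < d \<Longrightarrow> d \<le> d0 \<Longrightarrow> Jopt P a \<le> \<alpha> \<Longrightarrow>
      norm (y - optx P a (samp P)) \<le> D * d * norm a \<Longrightarrow> Jopt P y \<le> \<theta> * Jopt P a"
    using M.inexact_decrease[OF D, unfolded M\<alpha>] by blast
  obtain m where m: "0 < m" "\<And>a. Jopt P a \<le> \<alpha> \<Longrightarrow> m * (norm a)\<^sup>2 \<le> Jopt P a"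
    using M.J_lower[unfolded M\<alpha>] by metis
  define d where "d = min dmax d0"
  have d: "0 < d" "d \<le> dmax" "d \<le> d0" using dmax d0 by (auto simp: d_def)
  define A where "A = level P (alpha_hat P ml Ml MV Lf Lks Lk C \<alpha> d)"
  have A: "Jopt P x0 \<le> \<alpha>" if "x0 \<in> A" for x0
    using that alpha_hat_le[OF standing L hyp5(2) \<alpha>0, of d] d by (simp add: A_def level_def)
  \<comment> \<open>The level set of \<open>\<alpha>\<close> is not left because the optimal cost decreases.\<close>
  have loop: "Jopt P (state_at P d x0 k) \<le> \<theta> ^ k * \<alpha> \<and> active P \<alpha> d x0 k"
    if x0: "x0 \<in> A" and "\<forall>j<k. halts P d x0 j" for x0 k
    using that(2)
  proof (induction k)
    case 0
    then show ?case using A[OF x0] by (simp add: state_at_def active_def level_def)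
  next
    case (Suc k)
    then have IH: "Jopt P (state_at P d x0 k) \<le> \<theta> ^ k * \<alpha>" "active P \<alpha> d x0 k" and h: "halts P d x0 k"
      by auto
    have "state_at P d x0 (Suc k) = xF_at P d x0 k (samp P)"
      by (simp add: state_at_def xF_at_def start_at_def q_at_def Let_def)
    then have "norm (state_at P d x0 (Suc k) - optx P (state_at P d x0 k) (samp P)) \<le> D * d * norm (state_at P d x0 k)"
      using err[OF d(1,2) IH(2) h, of "samp P"] samp by simp
    then have "Jopt P (state_at P d x0 (Suc k)) \<le> \<theta> * Jopt P (state_at P d x0 k)"
      using decrease[OF d(1,3)] IH(2) by (simp add: active_def level_def)
    also have "\<dots> \<le> \<theta> * (\<theta> ^ k * \<alpha>)" using IH(1) \<theta> by (intro mult_left_mono) auto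
    finally have J: "Jopt P (state_at P d x0 (Suc k)) \<le> \<theta> ^ Suc k * \<alpha>" by simp
    also have "\<dots> \<le> 1 * \<alpha>" using \<theta> \<alpha>0 by (intro mult_right_mono power_le_one) auto
    finally have "active P \<alpha> d x0 (Suc k)"
      using Suc.prems A[OF x0] by (simp add: active_def level_def)
    then show ?case using J by blast
  qed
  define \<phi> where "\<phi> = sqrt \<theta>"
  have \<phi>: "0 < \<phi>" "\<phi> < 1" using \<theta> by (auto simp: \<phi>_def)
  define R where "R = sqrt (\<alpha> / m)"
  have R: "0 \<le> R" using \<alpha>0 m(1) by (simp add: R_def)
  have state: "norm (state_at P d x0 k) \<le> R * \<phi> ^ k" if "x0 \<in> A" "\<forall>j<k. halts P d x0 j" for x0 k
  proof -
    have J: "Jopt P (state_at P d x0 k) \<le> \<theta> ^ k * \<alpha>" "Jopt P (state_at P d x0 k) \<le> \<alpha>"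
      using loop[OF that] by (auto simp: active_def level_def)
    then have "m * (norm (state_at P d x0 k))\<^sup>2 \<le> \<theta> ^ k * \<alpha>" using m(2) by force
    then have "(norm (state_at P d x0 k))\<^sup>2 \<le> \<theta> ^ k * \<alpha> / m" using m(1) by (simp add: field_simps)
    then have "norm (state_at P d x0 k) \<le> sqrt (\<theta> ^ k * \<alpha> / m)" by (rule real_le_rsqrt)
    also have "\<dots> = R * \<phi> ^ k" by (simp add: R_def \<phi>_def real_sqrt_mult real_sqrt_divide real_sqrt_power)
    finally show ?thesis .
  qed
  have error: "norm (xF_at P d x0 k t - optx P (state_at P d x0 k) t) \<le> D * d * (R * \<phi> ^ k)"
    if "x0 \<in> A" "\<forall>j\<le>k. halts P d x0 j" "t \<in> {0..hor P}" for x0 k t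
  proof -
    have "norm (xF_at P d x0 k t - optx P (state_at P d x0 k) t) \<le> D * d * norm (state_at P d x0 k)"
      using loop[of x0 k] that by (intro err d) auto
    also have "\<dots> \<le> D * d * (R * \<phi> ^ k)"
      using state[of x0 k] that D d by (intro mult_left_mono) auto
    finally show ?thesis .
  qed
  have "exp_decay_on A (\<lambda>x0 k. \<forall>j<k. halts P d x0 j) (\<lambda>x0 k. Jopt P (state_at P d x0 k))"
  proof (rule exp_decay_onI[of "\<alpha> + 1" \<theta>])
    fix x0 k assume "x0 \<in> A" "\<forall>j<k. halts P d x0 j"
    then have "Jopt P (state_at P d x0 k) \<le> \<theta> ^ k * \<alpha>" using loop by blast
    also have "\<dots> \<le> \<theta> ^ k * (\<alpha> + 1)" using \<theta> by (intro mult_left_mono) auto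
    finally show "Jopt P (state_at P d x0 k) \<le> (\<alpha> + 1) * \<theta> ^ k" by (simp add: mult.commute)
  qed (use \<theta> \<alpha>0 in auto)
  moreover have "exp_decay_on A (\<lambda>x0 k. \<forall>j\<le>k. halts P d x0 j) (\<lambda>x0 k. err_norm P d x0 k)"
  proof (rule exp_decay_onI[of "D * d * R + 1" \<phi>])
    show "0 < D * d * R + 1" using D d R by (simp add: add_nonneg_pos)
    fix x0 k assume x0: "x0 \<in> A" "\<forall>j\<le>k. halts P d x0 j"
    have "err_norm P d x0 k \<le> D * d * (R * \<phi> ^ k)"
      unfolding err_norm_def by (rule supnorm_le) (use T error[OF x0] in auto)
    also have "\<dots> = D * d * R * \<phi> ^ k" by simp
    also have "\<dots> \<le> (D * d * R + 1) * \<phi> ^ k" using \<phi> by (intro mult_right_mono) auto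
    finally show "err_norm P d x0 k \<le> (D * d * R + 1) * \<phi> ^ k" .
  qed (use \<phi> in auto)
  moreover have "\<exists>\<gamma>1 \<gamma>2. 0 < \<gamma>1 \<and> 0 < \<gamma>2 \<and>
      (\<forall>x0\<in>A. \<forall>t\<ge>0. (\<forall>j\<le>nat \<lfloor>t / samp P\<rfloor>. halts P d x0 j) \<longrightarrow>
         norm (plant_state P d x0 t) \<le> \<gamma>1 * exp (- \<gamma>2 * t))"
  proof (intro exI conjI ballI allI impI)
    let ?\<gamma>2 = "- ln \<phi> / samp P"
    let ?G = "(exp (Lhat Lf Lks * hor P) + D * d) * R + 1"
    have G: "0 < ?G" using D d R by (intro add_nonneg_pos mult_nonneg_nonneg add_nonneg_nonneg) auto
    show "0 < ?G / \<phi>" using G \<phi> by simp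
    show "0 < ?\<gamma>2" using \<phi> samp by (simp add: divide_neg_pos)
    fix x0 t assume x0: "x0 \<in> A" and t: "0 \<le> t" and h: "\<forall>j\<le>nat \<lfloor>t / samp P\<rfloor>. halts P d x0 j"
    define k where "k = nat \<lfloor>t / samp P\<rfloor>"
    define r where "r = t - real k * samp P"
    have "0 \<le> t / samp P" using t samp by simp
    then have k: "real k \<le> t / samp P" "t / samp P < real k + 1"
      unfolding k_def by linarith+
    then have "real k * samp P \<le> t" "t < (real k + 1) * samp P"
      using samp by (simp_all add: pos_le_divide_eq pos_divide_less_eq)
    then have r: "r \<in> {0..hor P}" using samp by (simp add: r_def algebra_simps)
    have J: "Jopt P (state_at P d x0 k) \<le> \<alpha>"
      using loop[OF x0, of k] h by (auto simp: active_def level_def k_def)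
    have s: "norm (state_at P d x0 k) \<le> R * \<phi> ^ k" using state[OF x0, of k] h by (auto simp: k_def)
    have "norm (plant_state P d x0 t) = norm (xF_at P d x0 k r)"
      by (simp add: plant_state_def Let_def k_def r_def)
    also have "\<dots> \<le> norm (optx P (state_at P d x0 k) r) + norm (xF_at P d x0 k r - optx P (state_at P d x0 k) r)"
      by (rule norm_triangle_sub)
    also have "\<dots> \<le> exp (Lhat Lf Lks * hor P) * (R * \<phi> ^ k) + D * d * (R * \<phi> ^ k)"
    proof (rule add_mono)
      show "norm (optx P (state_at P d x0 k) r) \<le> exp (Lhat Lf Lks * hor P) * (R * \<phi> ^ k)"
        by (rule order_trans[OF M.optimal_growth[unfolded M\<alpha>, OF J r] mult_left_mono[OF s]]) simp
      show "norm (xF_at P d x0 k r - optx P (state_at P d x0 k) r) \<le> D * d * (R * \<phi> ^ k)"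
        using error[OF x0 _ r, of k] h by (simp add: k_def)
    qed
    also have "\<dots> = (?G - 1) * \<phi> ^ k" by (simp add: algebra_simps)
    also have "\<dots> \<le> ?G * \<phi> ^ k" using \<phi> by (intro mult_right_mono) auto
    also have "\<dots> \<le> ?G * (exp (- ?\<gamma>2 * t) / \<phi>)"
    proof (rule mult_left_mono)
      \<comment> \<open>The step index \<open>k\<close> exceeds \<open>t / samp P - 1\<close>; the factor \<open>1 / \<phi>\<close> pays for the \<open>1\<close>.\<close>
      have "(real k + 1) * ln \<phi> \<le> t / samp P * ln \<phi>"
        using k(2) \<phi> by (intro mult_right_mono_neg) auto
      then have "exp ((real k + 1) * ln \<phi>) \<le> exp (- ?\<gamma>2 * t)" by (simp add: mult.commute)
      moreover have "exp ((real k + 1) * ln \<phi>) = \<phi> ^ k * \<phi>"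
        using \<phi> by (simp add: distrib_right exp_add exp_of_nat_mult)
      ultimately show "\<phi> ^ k \<le> exp (- ?\<gamma>2 * t) / \<phi>" using \<phi> by (simp add: pos_le_divide_eq)
    qed (use G in simp)
    finally show "norm (plant_state P d x0 t) \<le> ?G / \<phi> * exp (- ?\<gamma>2 * t)" by simp
  qed
  ultimately show ?thesis
    unfolding Let_def A_def using d by blast
qed

end
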